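(* Let $(A,d,c,x^* )$ be an input to G-CONFIG-SP (see context). If $|\{i\in\{1,\dots,n\}: x^*_i\in(0,1)\}|\le\alpha$, then a generalized $(1,k)$-configuration inequality (for some $k$), with respect to some row constraint of $Ax\le d$, that is violated by $x^*$ can be found in $O(n^2\cdot 2^\alpha\cdot\log n\cdot m)$ time, if one exists.
   Context: $\mathbb{Z}_+$ denotes the nonnegative integers. An input to G-CONFIG-SP consists of $A\in\mathbb{Z}_+^{m\times n}$, $d\in\mathbb{Z}_+^m$, $c\in\mathbb{Z}_+^n$ and an optimal solution $x^*$ to the LP relaxation $\max\{c^{\mathsf T}x: Ax\le d,\ x\in[0,1]^n\}$. With respect to a row constraint $a^{\mathsf T}x\le b$ of $Ax\le d$: a cover is a set $C\subseteq\{1,\dots,n\}$ with $\sum_{i\in C}a_i>b$. For a nonnegative integer $k$, a set $N\cup\{t\}$ with $N\subsetneq\{1,\dots,n\}$, $t\in\{1,\dots,n\}\setminus N$ and $k\le|N|$ is a generalized $(1,k)$-configuration if $Q\cup\{t\}$ is a cover for every $Q\subseteq N$ with $|Q|=k$. Its generalized $(1,k)$-configuration inequality is $(n'-k+1)x_t+\sum_{i\in N}x_i\le n'$, where $n'$ is the smallest number such that $\sum_{i\in N}x_i\le n'$ is valid for $\operatorname{conv}(\{x\in\{0,1\}^n: a^{\mathsf T}x\le b\})$. "Violated by $x^*$" (separating) means that $x^*$ does not satisfy the inequality. *)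

theory Defs
  imports "HOL-Analysis.Analysis" "HOL-Library.Function_Algebras"
begin

section \<open>Generalized $(1,k)$-configuration inequalities\<close>

text \<open>
  Indices are 0-based.  A vector of dimension \<open>n\<close> is a function on \<open>nat\<close> of which only the
  values at \<open>i < n\<close> matter.  The pointwise real vector space structure on functions makes
  \<^const>\<open>hull\<close> and \<^const>\<open>convex\<close> applicable without fixing \<open>n\<close> in a type.
\<close>

instantiation "fun" :: (type, real_vector) real_vector
begin

definition scaleR_fun :: "real \<Rightarrow> ('a \<Rightarrow> 'b) \<Rightarrow> 'a \<Rightarrow> 'b"
  where "scaleR_fun r f = (\<lambda>i. r *\<^sub>R f i)"

instance
  by standard (simp_all add: scaleR_fun_def fun_eq_iff scaleR_add_right scaleR_add_left)

end

definition is_cover :: "nat \<Rightarrow> (nat \<Rightarrow> nat) \<Rightarrow> nat \<Rightarrow> nat set \<Rightarrow> bool"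
  where "is_cover n a b C \<longleftrightarrow> C \<subseteq> {..<n} \<and> (\<Sum>i\<in>C. a i) > b"

definition gen_config :: "nat \<Rightarrow> (nat \<Rightarrow> nat) \<Rightarrow> nat \<Rightarrow> nat set \<Rightarrow> nat \<Rightarrow> nat \<Rightarrow> bool"
  where "gen_config n a b N t k \<longleftrightarrow>
    N \<subset> {..<n} \<and> t \<in> {..<n} - N \<and> k \<le> card N \<and>
    (\<forall>Q. Q \<subseteq> N \<and> card Q = k \<longrightarrow> is_cover n a b (insert t Q))"

text \<open>Coordinates at \<open>i \<ge> n\<close> are normalised to 0.\<close>

definition knapsack_points :: "nat \<Rightarrow> (nat \<Rightarrow> nat) \<Rightarrow> nat \<Rightarrow> (nat \<Rightarrow> real) set"
  where "knapsack_points n a b =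
    {x. (\<forall>i<n. x i \<in> {0, 1}) \<and> (\<forall>i\<ge>n. x i = 0) \<and> (\<Sum>i<n. real (a i) * x i) \<le> real b}"

definition gc_rhs :: "nat \<Rightarrow> (nat \<Rightarrow> nat) \<Rightarrow> nat \<Rightarrow> nat set \<Rightarrow> real"
  where "gc_rhs n a b N =
    (LEAST r. \<forall>x \<in> convex hull (knapsack_points n a b). (\<Sum>i\<in>N. x i) \<le> r)"

definition gc_inequality ::
    "nat \<Rightarrow> (nat \<Rightarrow> nat) \<Rightarrow> nat \<Rightarrow> nat set \<Rightarrow> nat \<Rightarrow> nat \<Rightarrow> (nat \<Rightarrow> real) \<Rightarrow> bool"
  where "gc_inequality n a b N t k x \<longleftrightarrow>
    (gc_rhs n a b N - real k + 1) * x t + (\<Sum>i\<in>N. x i) \<le> gc_rhs n a b N"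

definition violated_gc ::
    "nat \<Rightarrow> nat \<Rightarrow> (nat \<Rightarrow> nat \<Rightarrow> nat) \<Rightarrow> (nat \<Rightarrow> nat) \<Rightarrow> (nat \<Rightarrow> real) \<Rightarrow>
     nat \<Rightarrow> nat set \<Rightarrow> nat \<Rightarrow> nat \<Rightarrow> bool"
  where "violated_gc m n A d x r N t k \<longleftrightarrow>
    r < m \<and> gen_config n (A r) (d r) N t k \<and> \<not> gc_inequality n (A r) (d r) N t k x"

definition lp_feasible ::
    "nat \<Rightarrow> nat \<Rightarrow> (nat \<Rightarrow> nat \<Rightarrow> nat) \<Rightarrow> (nat \<Rightarrow> nat) \<Rightarrow> (nat \<Rightarrow> real) \<Rightarrow> bool"
  where "lp_feasible m n A d x \<longleftrightarrow>
    (\<forall>i<n. 0 \<le> x i \<and> x i \<le> 1) \<and> (\<forall>r<m. (\<Sum>i<n. real (A r i) * x i) \<le> real (d r))"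

definition lp_optimal ::
    "nat \<Rightarrow> nat \<Rightarrow> (nat \<Rightarrow> nat \<Rightarrow> nat) \<Rightarrow> (nat \<Rightarrow> nat) \<Rightarrow> (nat \<Rightarrow> nat) \<Rightarrow> (nat \<Rightarrow> real) \<Rightarrow> bool"
  where "lp_optimal m n A d c x \<longleftrightarrow>
    lp_feasible m n A d x \<and>
    (\<forall>y. lp_feasible m n A d y \<longrightarrow> (\<Sum>i<n. real (c i) * y i) \<le> (\<Sum>i<n. real (c i) * x i))"


section \<open>Machine model\<close>

text \<open>
  Running time is the number of elementary steps of a deterministic random access machine,
  presented as a while language over finitely many named arrays (a scalar variable is cell 0
  of an array).  There are natural number arrays, which also supply array indices, and real
  arrays.  Constants, array accesses, additions, subtractions and comparisons cost one step each.
  There is no multiplication, division, rounding or bit operation, and all constants are natural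
  numbers, so that unit cost cannot be abused to manipulate huge numbers or to hide
  information in a constant.
\<close>

record state =
  nats :: "string \<Rightarrow> nat \<Rightarrow> nat"
  reals :: "string \<Rightarrow> nat \<Rightarrow> real"

text \<open>\<open>NSub\<close> is truncated subtraction.\<close>

datatype nexp = NConst nat | NGet string nexp | NAdd nexp nexp | NSub nexp nexp

datatype rexp = ROfNat nexp | RGet string nexp | RAdd rexp rexp | RSub rexp rexp

datatype bexp = NLess nexp nexp | RLess rexp rexp | BNot bexp | BAnd bexp bexp

datatype com =
    Skip
  | NSet string nexp nexp  \<comment> \<open>array, index, new value\<close>
  | RSet string nexp rexp
  | Seq com com
  | Cond bexp com com
  | While bexp com

primrec nval :: "nexp \<Rightarrow> state \<Rightarrow> nat" where
  "nval (NConst k) s = k"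
| "nval (NGet v e) s = nats s v (nval e s)"
| "nval (NAdd e f) s = nval e s + nval f s"
| "nval (NSub e f) s = nval e s - nval f s"

primrec rval :: "rexp \<Rightarrow> state \<Rightarrow> real" where
  "rval (ROfNat e) s = real (nval e s)"
| "rval (RGet v e) s = reals s v (nval e s)"
| "rval (RAdd e f) s = rval e s + rval f s"
| "rval (RSub e f) s = rval e s - rval f s"

primrec bval :: "bexp \<Rightarrow> state \<Rightarrow> bool" where
  "bval (NLess e f) s \<longleftrightarrow> nval e s < nval f s"
| "bval (RLess e f) s \<longleftrightarrow> rval e s < rval f s"
| "bval (BNot p) s \<longleftrightarrow> \<not> bval p s"
| "bval (BAnd p q) s \<longleftrightarrow> bval p s \<and> bval q s"

primrec ncost :: "nexp \<Rightarrow> nat" where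
  "ncost (NConst k) = 1"
| "ncost (NGet v e) = ncost e + 1"
| "ncost (NAdd e f) = ncost e + ncost f + 1"
| "ncost (NSub e f) = ncost e + ncost f + 1"

primrec rcost :: "rexp \<Rightarrow> nat" where
  "rcost (ROfNat e) = ncost e + 1"
| "rcost (RGet v e) = ncost e + 1"
| "rcost (RAdd e f) = rcost e + rcost f + 1"
| "rcost (RSub e f) = rcost e + rcost f + 1"

primrec bcost :: "bexp \<Rightarrow> nat" where
  "bcost (NLess e f) = ncost e + ncost f + 1"
| "bcost (RLess e f) = rcost e + rcost f + 1"
| "bcost (BNot p) = bcost p + 1"
| "bcost (BAnd p q) = bcost p + bcost q + 1"

definition nset :: "string \<Rightarrow> nat \<Rightarrow> nat \<Rightarrow> state \<Rightarrow> state"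
  where "nset v i a s = s\<lparr>nats := (nats s)(v := (nats s v)(i := a))\<rparr>"

definition rset :: "string \<Rightarrow> nat \<Rightarrow> real \<Rightarrow> state \<Rightarrow> state"
  where "rset v i a s = s\<lparr>reals := (reals s)(v := (reals s v)(i := a))\<rparr>"

text \<open>\<open>exec P s T s'\<close>: started in \<open>s\<close>, program \<open>P\<close> halts in \<open>s'\<close> after exactly \<open>T\<close> steps.\<close>

inductive exec :: "com \<Rightarrow> state \<Rightarrow> nat \<Rightarrow> state \<Rightarrow> bool" where
  Skip: "exec Skip s 1 s"
| NSet: "exec (NSet v e f) s (ncost e + ncost f + 1) (nset v (nval e s) (nval f s) s)"
| RSet: "exec (RSet v e f) s (ncost e + rcost f + 1) (rset v (nval e s) (rval f s) s)"
| Seq: "exec P s T s' \<Longrightarrow> exec Q s' U s'' \<Longrightarrow> exec (Seq P Q) s (T + U) s''"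
| CondTrue: "bval p s \<Longrightarrow> exec P s T s' \<Longrightarrow> exec (Cond p P Q) s (bcost p + T + 1) s'"
| CondFalse: "\<not> bval p s \<Longrightarrow> exec Q s T s' \<Longrightarrow> exec (Cond p P Q) s (bcost p + T + 1) s'"
| WhileFalse: "\<not> bval p s \<Longrightarrow> exec (While p P) s (bcost p + 1) s"
| WhileTrue: "bval p s \<Longrightarrow> exec P s T s' \<Longrightarrow> exec (While p P) s' U s'' \<Longrightarrow>
    exec (While p P) s (bcost p + T + U + 1) s''"

lemma exec_deterministic:
  "exec P s T s' \<Longrightarrow> exec P s U s'' \<Longrightarrow> U = T \<and> s'' = s'"
proof (induction arbitrary: U s'' rule: exec.induct)
  case (Seq P s T s' Q U0 s0)
  from Seq.prems show ?case by (cases rule: exec.cases) (auto dest: Seq.IH)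
next
  case (CondTrue p s P T s' Q)
  from CondTrue.prems CondTrue.hyps show ?case by (cases rule: exec.cases) (auto dest: CondTrue.IH)
next
  case (CondFalse p s Q T s' P)
  from CondFalse.prems CondFalse.hyps show ?case by (cases rule: exec.cases) (auto dest: CondFalse.IH)
next
  case (WhileTrue p s P T s' U0 s0)
  from WhileTrue.prems WhileTrue.hyps show ?case
    by (cases rule: exec.cases) (auto dest: WhileTrue.IH)
qed (auto elim: exec.cases)


section \<open>Input and output\<close>

text \<open>The matrix is stored row by row; all cells not holding input are 0.\<close>

definition input_state ::
    "nat \<Rightarrow> nat \<Rightarrow> (nat \<Rightarrow> nat \<Rightarrow> nat) \<Rightarrow> (nat \<Rightarrow> nat) \<Rightarrow> (nat \<Rightarrow> nat) \<Rightarrow> (nat \<Rightarrow> real) \<Rightarrow> state"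
  where "input_state m n A d c x =
    \<lparr> nats = (\<lambda>v j.
        if v = ''m'' \<and> j = 0 then m
        else if v = ''n'' \<and> j = 0 then n
        else if v = ''A'' \<and> j < m * n then A (j div n) (j mod n)
        else if v = ''d'' \<and> j < m then d j
        else if v = ''c'' \<and> j < n then c j
        else 0),
      reals = (\<lambda>v j. if v = ''x'' \<and> j < n then x j else 0) \<rparr>"

text \<open>
  The program either reports that no violated inequality exists, or outputs one explicitly:
  its row, its configuration (\<open>N\<close> as a characteristic vector) and its right-hand side.
\<close>

definition correct_output ::
    "nat \<Rightarrow> nat \<Rightarrow> (nat \<Rightarrow> nat \<Rightarrow> nat) \<Rightarrow> (nat \<Rightarrow> nat) \<Rightarrow> (nat \<Rightarrow> real) \<Rightarrow> state \<Rightarrow> bool"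
  where "correct_output m n A d x s \<longleftrightarrow>
    (if nats s ''found'' 0 = 0
     then \<not> (\<exists>r N t k. violated_gc m n A d x r N t k)
     else let r = nats s ''row'' 0; N = {j. j < n \<and> nats s ''N'' j \<noteq> 0};
              t = nats s ''t'' 0; k = nats s ''k'' 0
          in violated_gc m n A d x r N t k \<and>
             real (nats s ''rhs'' 0) = gc_rhs n (A r) (d r) N)"

end

theory Submission
  imports Defs
begin

text \<open>
  For a set \<open>N\<close> let \<open>cap e N\<close> count the cardinalities of those subsets of \<open>N\<close> that fit into the
  knapsack next to an item of weight \<open>e\<close>; as these cardinalities are downward closed, the right-hand side
  of the inequality is \<open>cap 0 N - 1\<close>, and the smallest admissible \<open>k\<close>, which gives the strongest
  inequality, is \<open>cap (a t) N\<close>.  Adding one element to \<open>N\<close> raises each capacity by at most one.  Hence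
  a violated inequality stays violated if elements with \<open>x i = 1\<close> are added to \<open>N\<close> and elements
  with \<open>x i = 0\<close> are removed from it, so only the sets \<open>{i. x i = 1} \<union> G - {t}\<close> with \<open>G\<close> a set of
  fractional indices matter.  There are \<open>2 ^ \<alpha>\<close> sets \<open>G\<close> and \<open>n\<close> indices \<open>t\<close> per row, and once the
  row is sorted, both capacities are found greedily in one linear scan.
\<close>

section \<open>Capacities of item sets\<close>

text \<open>Adding an element \<open>i\<close> to \<open>N\<close> moves the right-hand side and the
  smallest \<open>k\<close> together, so its effect on the violation is not evident. If
  \<open>cap 0\<close> and \<open>cap (a t)\<close> grow by \<open>u\<close> and \<open>v\<close>,
  both 0 or 1, left side minus right side grows by \<open>(u - v) * x t + x i - u\<close>. As
  \<open>0 \<le> x t \<le> 1\<close>, this is nonnegative for \<open>x i = 1\<close> and nonpositive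
  for \<open>x i = 0\<close>; a fractional \<open>x i\<close> leaves the sign open, which is why
  those indices must be enumerated. The delicate point is the condition
  \<open>k \<le> card N\<close>, which a removal could destroy. That happens only if
  \<open>N\<close> fits together with \<open>t\<close>, and then the inequality cannot have been
  violated before the removal. The machine has no multiplication. The product of the coefficient
  with \<open>x t\<close> is formed by at most \<open>n\<close> additions, row offsets advance by
  \<open>n\<close>, and the sets \<open>G\<close> are produced in place by a binary counter whose
  step costs O(n). Ranking a row by pairwise comparison is quadratic, but it happens once per row,
  outside the loop over \<open>G\<close>.\<close>

definition fits :: "('a \<Rightarrow> nat) \<Rightarrow> nat \<Rightarrow> nat \<Rightarrow> 'a set \<Rightarrow> nat set"
  where "fits a b e N = {card Q |Q. Q \<subseteq> N \<and> e + sum a Q \<le> b}"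

definition cap :: "('a \<Rightarrow> nat) \<Rightarrow> nat \<Rightarrow> nat \<Rightarrow> 'a set \<Rightarrow> nat"
  where "cap a b e N = card (fits a b e N)"

lemma fitsI: "Q \<subseteq> N \<Longrightarrow> e + sum a Q \<le> b \<Longrightarrow> card Q = c \<Longrightarrow> c \<in> fits a b e N"
  unfolding fits_def by blast

lemma fitsE:
  assumes "c \<in> fits a b e N"
  obtains Q where "Q \<subseteq> N" "e + sum a Q \<le> b" "card Q = c"
  using assms unfolding fits_def by blast

lemma fits_le_card: "finite N \<Longrightarrow> c \<in> fits a b e N \<Longrightarrow> c \<le> card N"
  by (auto elim!: fitsE intro: card_mono)

text \<open>Weights are nonnegative, so every subset of a fitting set fits.\<close>

lemma fits_downward:
  assumes "finite N" "c \<in> fits a b e N" "c' \<le> c"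
  shows "c' \<in> fits a b e N"
proof -
  obtain Q where Q: "Q \<subseteq> N" "e + sum a Q \<le> b" "card Q = c"
    using assms(2) by (rule fitsE)
  obtain R where R: "R \<subseteq> Q" "card R = c'"
    using assms(3) Q(3) obtain_subset_with_card_n[of c' Q] by auto
  have "sum a R \<le> sum a Q"
    using R(1) Q(1) assms(1) by (intro sum_mono2) (auto intro: finite_subset)
  then show ?thesis
    using Q R by (intro fitsI[of R]) auto
qed

lemma downward_closed_nat_set:
  fixes S :: "nat set"
  assumes "finite S" and down: "\<And>c c'. c \<in> S \<Longrightarrow> c' \<le> c \<Longrightarrow> c' \<in> S"
  shows "S = {..<card S}"
proof (cases "S = {}")
  case False
  have "S = {..Max S}"
  proof
    show "S \<subseteq> {..Max S}" using assms(1) by auto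
    show "{..Max S} \<subseteq> S" using down[OF Max_in[OF assms(1) False]] by blast
  qed
  then show ?thesis
    by (metis card_atMost lessThan_Suc_atMost)
qed simp

text \<open>An initial segment of the naturals is determined by its size, so membership becomes
  comparison with \<open>cap\<close>. Thus \<open>cap\<close> is one more than the largest fitting
  cardinality, and 0 when not even the empty set fits; counting avoids a maximum over a possibly
  empty set.\<close>

lemma fits_eq:
  assumes "finite N"
  shows "fits a b e N = {..<cap a b e N}"
  unfolding cap_def
proof (rule downward_closed_nat_set)
  show "finite (fits a b e N)"
    by (rule finite_subset[of _ "{..card N}"]) (use assms fits_le_card in auto)
qed (use assms fits_downward in blast)

lemma cap_le_card:
  assumes "finite N"
  shows "cap a b e N \<le> Suc (card N)"
proof -
  have "{..<cap a b e N} \<subseteq> {..<Suc (card N)}"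
  proof (rule subsetI)
    fix c assume "c \<in> {..<cap a b e N}"
    then have "c \<in> fits a b e N" by (simp add: fits_eq assms)
    then show "c \<in> {..<Suc (card N)}" using fits_le_card[OF assms] by fastforce
  qed
  then show ?thesis by (simp only: lessThan_subset_iff)
qed

lemma cap_pos: "finite N \<Longrightarrow> 0 < cap a b 0 N"
  using fitsI[of "{}" N 0 a b 0] by (simp add: fits_eq)

lemma cap_antimono: "finite N \<Longrightarrow> e' \<le> e \<Longrightarrow> cap a b e N \<le> cap a b e' N"
proof -
  assume "finite N" "e' \<le> e"
  then have "fits a b e N \<subseteq> fits a b e' N"
    unfolding fits_def by fastforce
  with \<open>finite N\<close> show ?thesis by (simp add: fits_eq)
qed

lemma cap_mono: "finite M \<Longrightarrow> N \<subseteq> M \<Longrightarrow> cap a b e N \<le> cap a b e M"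
proof -
  assume "finite M" "N \<subseteq> M"
  then have "fits a b e N \<subseteq> fits a b e M"
    unfolding fits_def by blast
  with \<open>finite M\<close> \<open>N \<subseteq> M\<close> show ?thesis by (simp add: fits_eq finite_subset)
qed

lemma cap_empty: "cap a b e {} = (if e \<le> b then 1 else 0)"
proof -
  have "fits a b e {} = (if e \<le> b then {0} else {})" by (auto simp: fits_def)
  then show ?thesis by (simp add: cap_def)
qed

text \<open>From a fitting set in \<open>insert i N\<close> drop \<open>i\<close>, or any element if
  \<open>i\<close> is absent: what remains lies in \<open>N\<close>, still fits and is only one
  smaller.\<close>

lemma cap_insert_le:
  assumes "finite N"
  shows "cap a b e (insert i N) \<le> Suc (cap a b e N)"
proof (rule ccontr)
  assume "\<not> ?thesis"
  then have "Suc (cap a b e N) \<in> fits a b e (insert i N)"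
    using assms by (simp add: fits_eq)
  then obtain Q where Q: "Q \<subseteq> insert i N" "e + sum a Q \<le> b" "card Q = Suc (cap a b e N)"
    by (rule fitsE)
  have fin: "finite Q" using Q(1) assms by (auto intro: finite_subset)
  obtain q where q: "q \<in> Q" "Q - {q} \<subseteq> N"
  proof (cases "i \<in> Q")
    case True then show ?thesis using Q(1) by (intro that[of i]) auto
  next
    case False
    moreover obtain q where "q \<in> Q" using Q(3) by fastforce
    ultimately show ?thesis using Q(1) by (intro that[of q]) auto
  qed
  have "sum a (Q - {q}) \<le> sum a Q" using fin by (intro sum_mono2) auto
  then have "cap a b e N \<in> fits a b e N"
    using Q q fin by (intro fitsI[of "Q - {q}"]) auto
  then show False using assms by (simp add: fits_eq)
qed

lemma cap_insert_cases:
  assumes "finite N"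
  obtains u where "cap a b e (insert i N) = cap a b e N + u" "u = 0 \<or> u = 1"
proof -
  have "cap a b e N \<le> cap a b e (insert i N)" using assms by (intro cap_mono) auto
  with cap_insert_le[OF assms, of a b e i] show ?thesis
    by (intro that[of "cap a b e (insert i N) - cap a b e N"]) auto
qed

text \<open>A set \<open>Q\<close> that contains \<open>i\<close> but is no larger than \<open>L\<close> misses an element of \<open>L\<close>,
  and exchanging \<open>i\<close> for it does not increase the weight.\<close>

lemma cap_insert_largest:
  assumes fin: "finite L" and i: "i \<notin> L" and max: "\<And>l. l \<in> L \<Longrightarrow> a l \<le> a i"
  shows "cap a b e (insert i L) = cap a b e L + (if e + (sum a L + a i) \<le> b then 1 else 0)"
proof -
  have small: "c \<in> fits a b e L" if c: "c \<in> fits a b e (insert i L)" and le: "c \<le> card L" for c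
  proof -
    obtain Q where Q: "Q \<subseteq> insert i L" "e + sum a Q \<le> b" "card Q = c"
      using c by (rule fitsE)
    have finQ: "finite Q" using Q(1) fin by (auto intro: finite_subset)
    show ?thesis
    proof (cases "i \<in> Q")
      case False then show ?thesis using Q by (intro fitsI[of Q]) auto
    next
      case True
      have "\<not> L \<subseteq> Q - {i}"
        using card_mono[of "Q - {i}" L] finQ True Q(3) le card_Diff1_less[of Q i] by auto
      then obtain l where l: "l \<in> L" "l \<notin> Q" using i by auto
      have "sum a Q = a i + sum a (Q - {i})" using finQ True by (rule sum.remove)
      moreover have "sum a (insert l (Q - {i})) = a l + sum a (Q - {i})"
        using finQ l by simp
      moreover have "card (insert l (Q - {i})) = c"
        using finQ l True Q(3) card_Suc_Diff1[of Q i] by simp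
      ultimately show ?thesis
        using Q l max[of l] by (intro fitsI[of "insert l (Q - {i})"]) auto
    qed
  qed
  \<comment> \<open>Only the whole of \<open>insert i L\<close> has this many elements, so the one
    cardinality not governed by \<open>small\<close> is decided by the total weight, a quantity that
    a scan can accumulate.\<close>
  have large: "Suc (card L) \<in> fits a b e (insert i L) \<longleftrightarrow> e + (sum a L + a i) \<le> b"
  proof
    assume "Suc (card L) \<in> fits a b e (insert i L)"
    then obtain Q where Q: "Q \<subseteq> insert i L" "e + sum a Q \<le> b" "card Q = Suc (card L)"
      by (rule fitsE)
    have "Q = insert i L" using Q fin i by (intro card_subset_eq) auto
    then show "e + (sum a L + a i) \<le> b" using Q fin i by (simp add: add_ac)
  next
    assume "e + (sum a L + a i) \<le> b"
    then show "Suc (card L) \<in> fits a b e (insert i L)"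
      using fin i by (intro fitsI[of "insert i L"]) (auto simp: add_ac)
  qed
  have full: "card L \<in> fits a b e L" if "e + (sum a L + a i) \<le> b"
    using that by (intro fitsI[of L]) auto
  have up: "cap a b e L \<le> cap a b e (insert i L)" using fin by (intro cap_mono) auto
  show ?thesis
  proof (cases "e + (sum a L + a i) \<le> b")
    case True
    then have "card L < cap a b e L" "Suc (card L) < cap a b e (insert i L)"
      using full large fin by (auto simp: fits_eq)
    moreover have "cap a b e L \<le> Suc (card L)" using fin by (rule cap_le_card)
    moreover have "cap a b e (insert i L) \<le> Suc (Suc (card L))"
      using cap_le_card[of "insert i L" a b e] fin i by simp
    ultimately show ?thesis using True by simp
  next
    case False
    have "cap a b e (insert i L) \<le> cap a b e L"
    proof (rule ccontr)
      assume "\<not> ?thesis"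
      then have mem: "cap a b e L \<in> fits a b e (insert i L)" using fin by (simp add: fits_eq)
      have "cap a b e L \<noteq> Suc (card L)" using mem large False by auto
      then have "cap a b e L \<le> card L" using cap_le_card[OF fin, of a b e] by simp
      then have "cap a b e L \<in> fits a b e L" using mem by (rule small[rotated])
      then show False using fin by (simp add: fits_eq)
    qed
    then show ?thesis using up False by simp
  qed
qed

section \<open>Configurations and their right-hand sides in terms of capacities\<close>

lemma gen_config_iff:
  assumes "N \<subseteq> {..<n}" "t < n" "t \<notin> N"
  shows "gen_config n a b N t k \<longleftrightarrow> k \<le> card N \<and> cap a b (a t) N \<le> k"
proof -
  have fin: "finite N" using assms(1) by (auto intro: finite_subset)
  have "is_cover n a b (insert t Q) \<longleftrightarrow> \<not> a t + sum a Q \<le> b" if "Q \<subseteq> N" for Q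
  proof -
    have "finite Q" "t \<notin> Q" using that fin assms by (auto intro: finite_subset)
    then show ?thesis using that assms by (auto simp: is_cover_def)
  qed
  \<comment> \<open>A \<open>k\<close>-subset violating the cover condition is exactly a
    \<open>k\<close>-subset that fits beside \<open>t\<close>, so the quantifier over all
    \<open>Q\<close> becomes a threshold on \<open>k\<close>.\<close>
  then have "(\<forall>Q. Q \<subseteq> N \<and> card Q = k \<longrightarrow> is_cover n a b (insert t Q)) \<longleftrightarrow> k \<notin> fits a b (a t) N"
    unfolding fits_def by auto
  then show ?thesis using assms fin by (auto simp: gen_config_def fits_eq)
qed

text \<open>Validity passes from the 0/1 points to their convex hull because a half-space is convex;
  the support of a 0/1 point within \<open>N\<close> is a fitting set. Minimality comes from a point
  attaining the bound.\<close>

lemma gc_rhs_eq: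
  assumes N: "N \<subseteq> {..<n}"
  shows "gc_rhs n a b N = real (cap a b 0 N) - 1"
  unfolding gc_rhs_def
proof (rule Least_equality)
  have fin: "finite N" using N by (auto intro: finite_subset)
  let ?H = "{x :: nat \<Rightarrow> real. (\<Sum>i\<in>N. x i) \<le> real (cap a b 0 N) - 1}"
  have "convex ?H"
  proof (rule convexI, clarsimp)
    fix x y :: "nat \<Rightarrow> real" and u v :: real
    assume *: "sum x N \<le> real (cap a b 0 N) - 1" "sum y N \<le> real (cap a b 0 N) - 1"
      "0 \<le> u" "0 \<le> v" "u + v = 1"
    have "(\<Sum>i\<in>N. (u *\<^sub>R x + v *\<^sub>R y) i) = u * sum x N + v * sum y N"
      by (simp add: scaleR_fun_def sum.distrib sum_distrib_left)
    also have "\<dots> \<le> real (cap a b 0 N) - 1"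
      using * by (intro convex_bound_le) auto
    finally show "(\<Sum>i\<in>N. (u *\<^sub>R x) i + (v *\<^sub>R y) i) \<le> real (cap a b 0 N) - 1" by simp
  qed
  moreover have "knapsack_points n a b \<subseteq> ?H"
  proof clarify
    fix x assume x: "x \<in> knapsack_points n a b"
    let ?Q = "{i \<in> N. x i = 1}"
    have x01: "x i = 0 \<or> x i = 1" if "i < n" for i using x that by (auto simp: knapsack_points_def)
    have "sum x N = sum x ?Q"
      using fin N x01 by (intro sum.mono_neutral_right) auto
    then have sum: "sum x N = real (card ?Q)" by simp
    have "real (sum a ?Q) = (\<Sum>i\<in>?Q. real (a i) * x i)" by simp
    also have "\<dots> \<le> (\<Sum>i<n. real (a i) * x i)"
      using N x01 by (intro sum_mono2) (force, force, force)
    also have "\<dots> \<le> real b" using x by (simp add: knapsack_points_def)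
    finally have "sum a ?Q \<le> b" by (simp only: of_nat_le_iff)
    then have "card ?Q \<in> fits a b 0 N" by (intro fitsI[of ?Q]) auto
    then show "sum x N \<le> real (cap a b 0 N) - 1" using sum fin by (simp add: fits_eq)
  qed
  ultimately have "convex hull (knapsack_points n a b) \<subseteq> ?H" by (rule hull_minimal[rotated])
  then show "\<forall>x\<in>convex hull knapsack_points n a b. sum x N \<le> real (cap a b 0 N) - 1" by auto
next
  fix r
  assume r: "\<forall>x\<in>convex hull knapsack_points n a b. sum x N \<le> r"
  have fin: "finite N" using N by (auto intro: finite_subset)
  \<comment> \<open>The cardinality 0 is counted too, so the largest fitting cardinality is
    \<open>cap a b 0 N - 1\<close>. The characteristic vector of a set of that size attains the
    bound.\<close>
  have "cap a b 0 N - 1 \<in> fits a b 0 N" using fin cap_pos[OF fin, of a b] by (simp add: fits_eq)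
  then obtain Q where Q: "Q \<subseteq> N" "0 + sum a Q \<le> b" "card Q = cap a b 0 N - 1" by (rule fitsE)
  let ?x = "\<lambda>i. if i \<in> Q then 1 else (0::real)"
  have eq: "{..<n} \<inter> Q = Q" "N \<inter> Q = Q" using Q(1) N by auto
  have "(\<Sum>i<n. real (a i) * ?x i) = (\<Sum>i<n. if i \<in> Q then real (a i) else 0)"
    by (intro sum.cong) auto
  also have "\<dots> = real (sum a Q)"
    by (simp add: sum.inter_restrict[symmetric] eq)
  also have "\<dots> \<le> real b" using Q(2) by (simp only: of_nat_le_iff add_0)
  finally have "?x \<in> knapsack_points n a b"
    using Q(1) N by (auto simp: knapsack_points_def)
  then have "sum ?x N \<le> r" using r hull_subset[of "knapsack_points n a b" convex] by blast
  moreover have "sum ?x N = real (card Q)" using fin by (simp add: sum.inter_restrict[symmetric] eq)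
  ultimately show "real (cap a b 0 N) - 1 \<le> r"
    using Q(3) cap_pos[OF fin, of a b] by simp
qed

section \<open>Moving a violated inequality to a canonical set\<close>

definition excess :: "('a \<Rightarrow> nat) \<Rightarrow> nat \<Rightarrow> ('a \<Rightarrow> real) \<Rightarrow> 'a \<Rightarrow> 'a set \<Rightarrow> real"
  where "excess a b x t N =
    (real (cap a b 0 N) - real (cap a b (a t) N)) * x t + sum x N + 1 - real (cap a b 0 N)"

text \<open>Here \<open>excess\<close> is left side minus right side of the inequality at
  \<open>k = cap a b (a t) N\<close>. For finite \<open>N\<close> the first conjunct says that all
  of \<open>N\<close> does not fit beside \<open>t\<close>, as otherwise the capacity would be
  \<open>Suc (card N)\<close>.\<close>

definition separates :: "('a \<Rightarrow> nat) \<Rightarrow> nat \<Rightarrow> ('a \<Rightarrow> real) \<Rightarrow> 'a \<Rightarrow> 'a set \<Rightarrow> bool"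
  where "separates a b x t N \<longleftrightarrow> cap a b (a t) N \<le> card N \<and> 0 < excess a b x t N"

lemma separates_iff:
  assumes "N \<subseteq> {..<n}" "t < n" "t \<notin> N"
  shows "separates a b x t N \<longleftrightarrow>
    gen_config n a b N t (cap a b (a t) N) \<and> \<not> gc_inequality n a b N t (cap a b (a t) N) x"
  using assms by (auto simp: separates_def excess_def gen_config_iff gc_inequality_def gc_rhs_eq algebra_simps)

text \<open>Since \<open>x t \<ge> 0\<close>, the smallest admissible \<open>k\<close> gives the strongest inequality.\<close>

lemma separates_if_violated:
  assumes "gen_config n a b N t k" "\<not> gc_inequality n a b N t k x" "0 \<le> x t"
  shows "separates a b x t N"
proof -
  have N: "N \<subseteq> {..<n}" "t < n" "t \<notin> N" using assms(1) by (auto simp: gen_config_def)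
  have k: "k \<le> card N" "cap a b (a t) N \<le> k" using assms(1) gen_config_iff[OF N] by auto
  have "(real (cap a b 0 N) - real k) * x t \<le> (real (cap a b 0 N) - real (cap a b (a t) N)) * x t"
    using k assms(3) by (intro mult_right_mono) auto
  then show ?thesis
    using assms(2) k N by (simp add: separates_def excess_def gc_inequality_def gc_rhs_eq)
qed

text \<open>With capacity increments \<open>u\<close> and \<open>v\<close>, the excess changes by
  \<open>(u - v) * x t + 1 - u\<close>, which is nonnegative in all four cases. The side condition
  survives since \<open>card N\<close> rises by one and the capacity by at most one.\<close>

lemma separates_insert_one:
  assumes "finite N" "i \<notin> N" "x i = 1" "0 \<le> x t" "x t \<le> 1" "separates a b x t N"
  shows "separates a b x t (insert i N)"
proof -
  obtain u v where uv: "cap a b 0 (insert i N) = cap a b 0 N + u"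
      "cap a b (a t) (insert i N) = cap a b (a t) N + v" "u = 0 \<or> u = 1" "v = 0 \<or> v = 1"
    using cap_insert_cases[OF assms(1)] by metis
  have "excess a b x t N \<le> excess a b x t (insert i N)"
    using uv assms by (auto simp: excess_def algebra_simps)
  then show ?thesis using assms(1,2,6) uv by (auto simp: separates_def)
qed

text \<open>Here the insertion changes the excess by \<open>(u - v) * x t - u\<close>, never
  positive, so removal cannot reduce it. The work lies in the side condition.\<close>

lemma separates_remove_zero:
  assumes "finite N" "i \<notin> N" "x i = 0" "0 \<le> x t" "x t \<le> 1" "\<And>j. j \<in> N \<Longrightarrow> x j \<le> 1"
    "separates a b x t (insert i N)"
  shows "separates a b x t N"
proof -
  obtain u v where uv: "cap a b 0 (insert i N) = cap a b 0 N + u"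
      "cap a b (a t) (insert i N) = cap a b (a t) N + v" "u = 0 \<or> u = 1" "v = 0 \<or> v = 1"
    using cap_insert_cases[OF assms(1)] by metis
  have "excess a b x t (insert i N) \<le> excess a b x t N"
    using uv assms by (auto simp: excess_def algebra_simps)
  \<comment> \<open>If it failed, both capacities of \<open>N\<close> would equal
    \<open>Suc (card N)\<close> and \<open>v\<close> would be 0. The excess of
    \<open>insert i N\<close> would then be \<open>u * (x t - 1) + sum x N - card N\<close>, which
    is at most 0 as all values are at most 1.\<close>
  moreover have "cap a b (a t) N \<le> card N"
  proof (rule ccontr)
    assume "\<not> ?thesis"
    then have "cap a b (a t) N = Suc (card N)" using cap_le_card[OF assms(1), of a b "a t"] by simp
    moreover have "cap a b (a t) (insert i N) \<le> Suc (card N)"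
      using assms by (simp add: separates_def)
    moreover have "cap a b (a t) N \<le> cap a b 0 N" using assms(1) by (intro cap_antimono) auto
    moreover have "cap a b 0 N \<le> Suc (card N)" using assms(1) by (rule cap_le_card)
    moreover have "sum x N \<le> real (card N)" using sum_mono[of N x "\<lambda>_. 1"] assms(6) by simp
    ultimately have "excess a b x t (insert i N) \<le> 0"
      using uv assms(1-5) by (auto simp: excess_def)
    then show False using assms(7) by (simp add: separates_def)
  qed
  ultimately show ?thesis using assms(7) by (auto simp: separates_def)
qed

lemma separates_canonical:
  assumes "finite S" and x: "\<And>i. i \<in> S \<Longrightarrow> 0 \<le> x i \<and> x i \<le> 1"
    and N: "N \<subseteq> S" "t \<in> S" "t \<notin> N" and sep: "separates a b x t N"
  shows "separates a b x t ({i \<in> S. x i = 1} \<union> {i \<in> N. 0 < x i \<and> x i < 1} - {t})"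
proof -
  have drop: "separates a b x t (N - Z)" if "finite Z" "Z \<subseteq> {i \<in> N. x i = 0}" for Z
    using that
  proof (induction Z)
    case empty show ?case using sep by simp
  next
    case (insert z Z)
    \<comment> \<open>The set before the removal is written as an insertion, the form in which
      \<open>separates_remove_zero\<close> consumes it.\<close>
    have "insert z (N - insert z Z) = N - Z" using insert by auto
    then show ?case
      using insert assms finite_subset[OF N(1)]
      by (intro separates_remove_zero[of "N - insert z Z" z x]) auto
  qed
  have add: "separates a b x t (M \<union> Z)"
    if "finite Z" "Z \<subseteq> {i \<in> S. x i = 1} - {t}" "finite M" "separates a b x t M" for M Z
    using that
  proof (induction Z)
    case (insert z Z)
    show ?case
    proof (cases "z \<in> M")
      case True then show ?thesis using insert by (simp add: insert_absorb)
    next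
      case False
      then have "separates a b x t (insert z (M \<union> Z))"
        using insert x[OF N(2)] by (intro separates_insert_one) auto
      then show ?thesis by simp
    qed
  qed simp
  have fin: "finite N" using N(1) assms(1) by (rule finite_subset)
  have "separates a b x t (N - {i \<in> N. x i = 0})" using drop fin by simp
  then have "separates a b x t ((N - {i \<in> N. x i = 0}) \<union> ({i \<in> S. x i = 1} - {t}))"
    using add fin assms(1) by simp
  moreover have "(N - {i \<in> N. x i = 0}) \<union> ({i \<in> S. x i = 1} - {t})
    = {i \<in> S. x i = 1} \<union> {i \<in> N. 0 < x i \<and> x i < 1} - {t}"
    using N x by (auto simp: order.order_iff_strict)
  ultimately show ?thesis by simp
qed

section \<open>Ranks and binary counting\<close>

text \<open>Ties are broken by index, which makes the ranks a permutation even when weights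
  repeat.\<close>

definition sort_rank :: "(nat \<Rightarrow> nat) \<Rightarrow> nat \<Rightarrow> nat \<Rightarrow> nat"
  where "sort_rank a n i = card {j. j < n \<and> (a j < a i \<or> a j = a i \<and> j < i)}"

lemma sort_rank_less:
  assumes "i < n" "a i < a j \<or> a i = a j \<and> i < j"
  shows "sort_rank a n i < sort_rank a n j"
  unfolding sort_rank_def using assms by (intro psubset_card_mono) auto

lemma sort_rank_bij: "bij_betw (sort_rank a n) {..<n} {..<n}"
proof -
  have "inj_on (sort_rank a n) {..<n}"
  proof (rule inj_onI)
    fix i j assume "i \<in> {..<n}" "j \<in> {..<n}" "sort_rank a n i = sort_rank a n j"
    then show "i = j"
      using sort_rank_less[of i n a j] sort_rank_less[of j n a i]
      by (cases i j rule: linorder_cases; cases "a i" "a j" rule: linorder_cases) auto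
  qed
  moreover have "sort_rank a n i < n" if "i < n" for i
  proof -
    have "sort_rank a n i \<le> card ({..<n} - {i})" unfolding sort_rank_def by (intro card_mono) auto
    then show ?thesis using that by simp
  qed
  ultimately show ?thesis
    by (intro bij_betw_imageI endo_inj_surj) auto
qed

definition sorts :: "(nat \<Rightarrow> nat) \<Rightarrow> (nat \<Rightarrow> nat) \<Rightarrow> nat \<Rightarrow> bool"
  where "sorts p a n \<longleftrightarrow> bij_betw p {..<n} {..<n} \<and> (\<forall>i j. i < j \<and> j < n \<longrightarrow> a (p i) \<le> a (p j))"

text \<open>A left inverse of the rank permutation is again a permutation, and it lists the columns
  in the order of their ranks.\<close>

lemma sorts_inverse_sort_rank:
  assumes p: "\<And>i. i < n \<Longrightarrow> p (sort_rank a n i) = i"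
  shows "sorts p a n"
  unfolding sorts_def
proof (intro conjI allI impI)
  note bij = sort_rank_bij[of a n]
  have "bij_betw (p \<circ> sort_rank a n) {..<n} {..<n}"
    using p by (subst bij_betw_cong[of _ _ id]) auto
  then show "bij_betw p {..<n} {..<n}" using bij by (simp add: bij_betw_comp_iff[symmetric])
  fix i j assume "i < j \<and> j < n"
  then obtain i' j' where "i' < n" "j' < n" "sort_rank a n i' = i" "sort_rank a n j' = j"
    using bij unfolding bij_betw_def by (metis imageE lessThan_iff order.strict_trans)
  then show "a (p i) \<le> a (p j)"
    using p sort_rank_less[of j' n a i'] \<open>i < j \<and> j < n\<close> by (metis leI not_less_iff_gr_or_eq)
qed

text \<open>The number whose binary digits, least significant first, indicate membership in
  \<open>G\<close> along the increasing enumeration of \<open>F\<close>. No program computes it; it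
  only measures the progress of the counter.\<close>

definition subset_code :: "nat set \<Rightarrow> nat set \<Rightarrow> nat"
  where "subset_code F G = (\<Sum>i\<in>G. 2 ^ card (F \<inter> {..<i}))"

lemma subset_code_initial: "Suc (subset_code F (F \<inter> {..<k})) = 2 ^ card (F \<inter> {..<k})"
proof (induction k)
  case 0 show ?case by (simp add: subset_code_def)
next
  case (Suc k)
  show ?case
  proof (cases "k \<in> F")
    case True
    then have "F \<inter> {..<Suc k} = insert k (F \<inter> {..<k})" by (auto simp: less_Suc_eq)
    then show ?thesis using Suc by (simp add: subset_code_def)
  next
    case False
    then have "F \<inter> {..<Suc k} = F \<inter> {..<k}" by (auto simp: less_Suc_eq)
    then show ?thesis using Suc by simp
  qed
qed

lemma subset_code_top:
  assumes "finite F"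
  shows "Suc (subset_code F F) = 2 ^ card F"
proof -
  obtain k where "F \<subseteq> {..<k}" using assms finite_nat_iff_bounded by blast
  then have "F \<inter> {..<k} = F" by auto
  then show ?thesis using subset_code_initial[of F k] by simp
qed

lemma subset_code_less:
  assumes "finite F" "G \<subseteq> F"
  shows "subset_code F G < 2 ^ card F"
proof -
  have "subset_code F G \<le> subset_code F F"
    unfolding subset_code_def using assms by (intro sum_mono2) auto
  then show ?thesis using subset_code_top[OF assms(1)] by simp
qed

text \<open>This is the carry: the digits below \<open>i\<close> are all ones and add up to one less
  than the digit at \<open>i\<close>, so clearing them and setting \<open>i\<close> gains exactly
  one.\<close>

lemma subset_code_succ:
  assumes "finite F" "G \<subseteq> F" "i \<in> F" "i \<notin> G" "F \<inter> {..<i} \<subseteq> G"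
  shows "subset_code F (insert i (G - {..<i})) = Suc (subset_code F G)"
proof -
  have fin: "finite G" using assms by (auto intro: finite_subset)
  have eq: "G \<inter> {..<i} = F \<inter> {..<i}" using assms by auto
  have "subset_code F G = subset_code F (G - {..<i}) + subset_code F (G \<inter> {..<i})"
    unfolding subset_code_def by (simp add: sum.Int_Diff[OF fin, of _ "{..<i}"])
  moreover have "subset_code F (insert i (G - {..<i})) = 2 ^ card (F \<inter> {..<i}) + subset_code F (G - {..<i})"
    unfolding subset_code_def using fin assms by simp
  ultimately show ?thesis using subset_code_initial[of F i] eq by simp
qed

text \<open>Pure counting: a family whose codes take \<open>2 ^ card F\<close> values has at least
  as many members, hence is the whole power set.\<close>

lemma Pow_if_all_codes:
  assumes "finite F" "V \<subseteq> Pow F" "{..<2 ^ card F} \<subseteq> subset_code F ` V"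
  shows "V = Pow F"
proof (rule card_seteq)
  have finV: "finite V" using assms(1,2) by (auto intro: finite_subset)
  have "2 ^ card F \<le> card (subset_code F ` V)"
    using card_mono[OF _ assms(3)] finV by simp
  then show "card (Pow F) \<le> card V"
    using card_image_le[OF finV, of "subset_code F"] assms(1) by (simp add: card_Pow)
qed (use assms in auto)

section \<open>Reasoning about running times\<close>

text \<open>A total correctness triple with a time budget. Where \<open>exec\<close> records exact
  step counts, budgets are upper bounds that can be rounded up and added.\<close>

definition halts_within :: "com \<Rightarrow> state \<Rightarrow> nat \<Rightarrow> (state \<Rightarrow> bool) \<Rightarrow> bool"
  where "halts_within P s B Q \<longleftrightarrow> (\<exists>T s'. exec P s T s' \<and> T \<le> B \<and> Q s')"

lemma halts_conseq:
  "halts_within P s B Q \<Longrightarrow> B \<le> B' \<Longrightarrow> (\<And>s'. Q s' \<Longrightarrow> Q' s') \<Longrightarrow> halts_within P s B' Q'"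
  unfolding halts_within_def by (meson order.trans)

lemma halts_seq:
  assumes "halts_within P s B Q" "\<And>s'. Q s' \<Longrightarrow> halts_within P' s' B' R" "B + B' \<le> C"
  shows "halts_within (Seq P P') s C R"
proof -
  obtain T s' where 1: "exec P s T s'" "T \<le> B" "Q s'"
    using assms(1) unfolding halts_within_def by blast
  obtain U s'' where 2: "exec P' s' U s''" "U \<le> B'" "R s''"
    using assms(2)[OF 1(3)] unfolding halts_within_def by blast
  from 1 2 assms(3) show ?thesis
    unfolding halts_within_def by (intro exI[of _ "T + U"] exI[of _ s'']) (auto intro: exec.Seq)
qed

lemma halts_cond:
  assumes "bval p s \<Longrightarrow> halts_within P s B Q" "\<not> bval p s \<Longrightarrow> halts_within P' s B Q"
    and "bcost p + B + 1 \<le> C"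
  shows "halts_within (Cond p P P') s C Q"
proof (cases "bval p s")
  case True
  then obtain T s' where "exec P s T s'" "T \<le> B" "Q s'"
    using assms(1) unfolding halts_within_def by blast
  with True assms(3) show ?thesis
    unfolding halts_within_def
    by (intro exI[of _ "bcost p + T + 1"] exI[of _ s'] conjI exec.CondTrue) auto
next
  case False
  then obtain T s' where "exec P' s T s'" "T \<le> B" "Q s'"
    using assms(2) unfolding halts_within_def by blast
  with False assms(3) show ?thesis
    unfolding halts_within_def
    by (intro exI[of _ "bcost p + T + 1"] exI[of _ s'] conjI exec.CondFalse) auto
qed

text \<open>The index of the invariant counts completed rounds. Since every entered round has index
  below \<open>M\<close>, the same premise yields termination and the bound; the terms outside the
  product pay for the last, failing test.\<close>

lemma halts_while:
  assumes init: "I 0 s"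
    and body: "\<And>i s. I i s \<Longrightarrow> bval p s \<Longrightarrow> i < M \<and> halts_within P s B (I (Suc i))"
    and final: "\<And>i s. I i s \<Longrightarrow> \<not> bval p s \<Longrightarrow> Q s"
    and cost: "M * (B + bcost p + 1) + bcost p + 1 \<le> C"
  shows "halts_within (While p P) s C Q"
proof -
  \<comment> \<open>Generalised to a start at any index \<open>i\<close>, with \<open>k\<close>
    rounds left of the \<open>M\<close> allowed.\<close>
  have "halts_within (While p P) s (k * (B + bcost p + 1) + bcost p + 1) Q"
    if "I i s" "M = i + k" for i k s
    using that
  proof (induction k arbitrary: i s)
    case 0
    then have "\<not> bval p s" using body by fastforce
    then show ?case
      using final[OF 0(1)] exec.WhileFalse[of p s P] unfolding halts_within_def by force
  next
    case (Suc k)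
    show ?case
    proof (cases "bval p s")
      case False
      then show ?thesis
        using final[OF Suc(2)] exec.WhileFalse[of p s P] unfolding halts_within_def by force
    next
      case True
      then obtain T s' where 1: "exec P s T s'" "T \<le> B" "I (Suc i) s'"
        using body[OF Suc(2)] unfolding halts_within_def by blast
      obtain U s'' where 2: "exec (While p P) s' U s''" "U \<le> k * (B + bcost p + 1) + bcost p + 1" "Q s''"
        using Suc.IH[OF 1(3)] Suc(3) unfolding halts_within_def by auto
      show ?thesis
        unfolding halts_within_def using 1 2 True
        by (intro exI[of _ "bcost p + T + U + 1"] exI[of _ s''] conjI exec.WhileTrue) auto
    qed
  qed
  from this[OF init, of M] show ?thesis by (rule halts_conseq) (use cost in auto)
qed

section \<open>Symbolic execution of loop-free code, and frame conditions\<close>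

primrec straight :: "com \<Rightarrow> bool" where
  "straight Skip = True"
| "straight (NSet v e f) = True"
| "straight (RSet v e f) = True"
| "straight (Seq P Q) = (straight P \<and> straight Q)"
| "straight (Cond p P Q) = (straight P \<and> straight Q)"
| "straight (While p P) = False"

text \<open>Makes the final state of loop-free code computable by simplification. The value at
  \<open>While\<close> is a dummy, excluded by \<open>straight\<close>.\<close>

primrec run :: "com \<Rightarrow> state \<Rightarrow> state" where
  "run Skip s = s"
| "run (NSet v e f) s = nset v (nval e s) (nval f s) s"
| "run (RSet v e f) s = rset v (nval e s) (rval f s) s"
| "run (Seq P Q) s = run Q (run P s)"
| "run (Cond p P Q) s = (if bval p s then run P s else run Q s)"
| "run (While p P) s = s"

primrec steps :: "com \<Rightarrow> nat" where
  "steps Skip = 1"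
| "steps (NSet v e f) = ncost e + ncost f + 1"
| "steps (RSet v e f) = ncost e + rcost f + 1"
| "steps (Seq P Q) = steps P + steps Q"
| "steps (Cond p P Q) = bcost p + max (steps P) (steps Q) + 1"
| "steps (While p P) = 0"

lemma straight_halts_steps: "straight P \<Longrightarrow> halts_within P s (steps P) (\<lambda>s'. s' = run P s)"
proof (induction P arbitrary: s)
  case (Seq P Q)
  then show ?case by (intro halts_seq[of P s "steps P" "\<lambda>s'. s' = run P s" Q "steps Q"]) auto
next
  case (Cond p P Q)
  show ?case
  proof (rule halts_cond[where B = "max (steps P) (steps Q)"])
    assume "bval p s"
    with Cond show "halts_within P s (max (steps P) (steps Q)) (\<lambda>s'. s' = run (Cond p P Q) s)"
      by (intro halts_conseq[OF Cond.IH(1)]) auto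
  next
    assume "\<not> bval p s"
    with Cond show "halts_within Q s (max (steps P) (steps Q)) (\<lambda>s'. s' = run (Cond p P Q) s)"
      by (intro halts_conseq[OF Cond.IH(2)]) auto
  qed simp
qed (auto simp: halts_within_def intro: exec.intros)

lemma halts_straight: "straight P \<Longrightarrow> steps P \<le> B \<Longrightarrow> Q (run P s) \<Longrightarrow> halts_within P s B Q"
  by (rule halts_conseq[OF straight_halts_steps]) auto

lemma nats_nset [simp]: "nats (nset v i e s) w = (if w = v then (nats s v)(i := e) else nats s w)"
  and reals_nset [simp]: "reals (nset v i e s) = reals s"
  and nats_rset [simp]: "nats (rset v i r s) = nats s"
  and reals_rset [simp]: "reals (rset v i r s) w = (if w = v then (reals s v)(i := r) else reals s w)"
  by (auto simp: nset_def rset_def)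

text \<open>A frame condition: natural and real arrays share the names in \<open>W\<close>, and only
  arrays named there may have changed.\<close>

definition keeps :: "string set \<Rightarrow> state \<Rightarrow> state \<Rightarrow> bool"
  where "keeps W s s' \<longleftrightarrow> (\<forall>v. v \<notin> W \<longrightarrow> nats s' v = nats s v \<and> reals s' v = reals s v)"

lemma keeps_refl [simp]: "keeps W s s"
  by (simp add: keeps_def)

lemma keeps_nset [simp]: "v \<in> W \<Longrightarrow> keeps W s (nset v i e s') \<longleftrightarrow> keeps W s s'"
  by (auto simp: keeps_def)

lemma keeps_rset [simp]: "v \<in> W \<Longrightarrow> keeps W s (rset v i e s') \<longleftrightarrow> keeps W s s'"
  by (auto simp: keeps_def)

lemma keeps_trans: "keeps W s s' \<Longrightarrow> keeps W' s' s'' \<Longrightarrow> W \<union> W' \<subseteq> W'' \<Longrightarrow> keeps W'' s s''"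
  unfolding keeps_def by (metis UnCI subsetD)

lemma keeps_mono: "keeps W s s' \<Longrightarrow> W \<subseteq> W' \<Longrightarrow> keeps W' s s'"
  unfolding keeps_def by blast

abbreviation Var :: "string \<Rightarrow> nexp" where "Var v \<equiv> NGet v (NConst 0)"

abbreviation Assign :: "string \<Rightarrow> nexp \<Rightarrow> com" where "Assign v e \<equiv> NSet v (NConst 0) e"

abbreviation Inc :: "string \<Rightarrow> com" where "Inc v \<equiv> Assign v (NAdd (Var v) (NConst 1))"

definition For :: "string \<Rightarrow> string \<Rightarrow> com \<Rightarrow> com"
  where "For v m P = Seq (Assign v (NConst 0)) (While (NLess (Var v) (Var m)) (Seq P (Inc v)))"

text \<open>The body establishes the invariant for the state after the counter update, so invariants
  may ignore or mention the counter. A round costs 12 beyond the body: 6 for the increment, 5 for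
  the test and 1 for the loop; the 9 consists of 3 for the initial assignment and 6 for the failing
  test.\<close>

lemma halts_for:
  assumes "I 0 (nset v 0 0 s)"
    and bound: "\<And>i s. I i s \<Longrightarrow> nats s m 0 = M"
    and body: "\<And>i s. I i s \<Longrightarrow> i < M \<Longrightarrow> nats s v 0 = i \<Longrightarrow>
      halts_within P s B (\<lambda>s'. nats s' v 0 = i \<and> I (Suc i) (nset v 0 (Suc i) s'))"
    and final: "\<And>s. I M s \<Longrightarrow> Q s"
    and cost: "M * (B + 12) + 9 \<le> C"
  shows "halts_within (For v m P) s C Q"
  unfolding For_def
proof (rule halts_seq[where Q = "\<lambda>s. I 0 s \<and> nats s v 0 = 0"])
  show "halts_within (Assign v (NConst 0)) s 3 (\<lambda>s. I 0 s \<and> nats s v 0 = 0)"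
    using assms(1) by (intro halts_straight) auto
  fix s' assume s': "I 0 s' \<and> nats s' v 0 = 0"
  show "halts_within (While (NLess (Var v) (Var m)) (Seq P (Inc v))) s' (M * (B + 12) + 6) Q"
  proof (rule halts_while[where I = "\<lambda>i s. I i s \<and> nats s v 0 = i \<and> i \<le> M" and M = M and B = "B + 6"])
    fix i s assume i: "I i s \<and> nats s v 0 = i \<and> i \<le> M" and "bval (NLess (Var v) (Var m)) s"
    then have less: "i < M" using bound[of i s] by simp
    have "halts_within (Seq P (Inc v)) s (B + 6) (\<lambda>s. I (Suc i) s \<and> nats s v 0 = Suc i \<and> Suc i \<le> M)"
    proof (rule halts_seq)
      show "halts_within P s B (\<lambda>s'. nats s' v 0 = i \<and> I (Suc i) (nset v 0 (Suc i) s'))"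
        using body i less by blast
      show "halts_within (Inc v) s' 6 (\<lambda>s. I (Suc i) s \<and> nats s v 0 = Suc i \<and> Suc i \<le> M)"
        if "nats s' v 0 = i \<and> I (Suc i) (nset v 0 (Suc i) s')" for s'
        using that less by (intro halts_straight) auto
    qed simp
    with less show "i < M \<and> halts_within (Seq P (Inc v)) s (B + 6)
      (\<lambda>s. I (Suc i) s \<and> nats s v 0 = Suc i \<and> Suc i \<le> M)" by simp
  next
    fix i s assume "I i s \<and> nats s v 0 = i \<and> i \<le> M" "\<not> bval (NLess (Var v) (Var m)) s"
    then show "Q s" using bound[of i s] final by auto
  qed (use s' in auto)
qed (use cost in auto)

section \<open>The separation program\<close>

text \<open>
  Variables: \<open>p\<close> lists the columns by increasing weight in the current row \<open>r\<close>, whose data are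
  \<open>a\<close>, \<open>b\<close> and whose offset in \<open>A\<close> is \<open>o\<close>; \<open>G\<close> marks the current set, and \<open>u\<close> is the current
  candidate for \<open>t\<close>.  Writing \<open>N\<close> for the marked set without \<open>u\<close>, a scan accumulates the weight \<open>s\<close>,
  the size \<open>l\<close> and the \<open>x\<close>-value \<open>w\<close> of the part of \<open>N\<close> read so far, together with its capacities
  \<open>g\<close> (for \<open>b\<close>) and \<open>h\<close> (for \<open>b\<close> with \<open>u\<close> already packed).
\<close>

definition NEq :: "nexp \<Rightarrow> nexp \<Rightarrow> bexp"
  where "NEq e f = BAnd (BNot (NLess e f)) (BNot (NLess f e))"

lemma bval_NEq [simp]: "bval (NEq e f) s \<longleftrightarrow> nval e s = nval f s"
  and bcost_NEq [simp]: "bcost (NEq e f) = 2 * ncost e + 2 * ncost f + 5"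
  by (auto simp: NEq_def)

definition selected :: "nat \<Rightarrow> state \<Rightarrow> nat set"
  where "selected n s = {i. i < n \<and> nats s ''G'' i \<noteq> 0}"

definition row_loaded ::
    "nat \<Rightarrow> (nat \<Rightarrow> nat) \<Rightarrow> nat \<Rightarrow> (nat \<Rightarrow> real) \<Rightarrow> state \<Rightarrow> bool"
  where "row_loaded n a b x s \<longleftrightarrow>
    nats s ''n'' 0 = n \<and> nats s ''b'' 0 = b \<and> (\<forall>j<n. nats s ''a'' j = a j) \<and>
    (\<forall>j<n. reals s ''x'' j = x j) \<and> sorts (nats s ''p'') a n"

lemma row_loaded_keeps:
  assumes "row_loaded n a b x s" "keeps W s s'" "W \<inter> {''n'', ''b'', ''a'', ''x'', ''p''} = {}"
  shows "row_loaded n a b x s'"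
proof -
  have "nats s' v = nats s v \<and> reals s' v = reals s v" if "v \<in> {''n'', ''b'', ''a'', ''x'', ''p''}" for v
    using assms(2,3) that unfolding keeps_def by blast
  then show ?thesis using assms(1) by (simp add: row_loaded_def)
qed

definition scan_step :: com
  where "scan_step =
    Seq (Assign ''i'' (NGet ''p'' (Var ''j'')))
      (Cond (BAnd (NLess (NConst 0) (NGet ''G'' (Var ''i''))) (BNot (NEq (Var ''i'') (Var ''u''))))
        (Seq (Assign ''s'' (NAdd (Var ''s'') (NGet ''a'' (Var ''i''))))
        (Seq (Inc ''l'')
        (Seq (RSet ''w'' (NConst 0) (RAdd (RGet ''w'' (NConst 0)) (RGet ''x'' (Var ''i''))))
        (Seq (Cond (NLess (Var ''b'') (Var ''s'')) Skip (Inc ''g''))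
          (Cond (NLess (Var ''b'') (NAdd (NGet ''a'' (Var ''u'')) (Var ''s''))) Skip (Inc ''h''))))))
        Skip)"

text \<open>The initial values of \<open>g\<close> and \<open>h\<close> are the capacities of the
  empty set: 1 for \<open>g\<close>, while \<open>h\<close> starts at 0 if \<open>u\<close> alone is
  already too heavy.\<close>

definition scan :: com
  where "scan =
    Seq (Seq (Assign ''s'' (NConst 0)) (Seq (Assign ''l'' (NConst 0)) (Seq (Assign ''g'' (NConst 1))
      (Seq (RSet ''w'' (NConst 0) (ROfNat (NConst 0)))
        (Cond (NLess (Var ''b'') (NGet ''a'' (Var ''u''))) (Assign ''h'' (NConst 0)) (Assign ''h'' (NConst 1)))))))
    (For ''j'' ''n'' scan_step)"

abbreviation "scan_vars \<equiv> {''i'', ''j'', ''s'', ''l'', ''g'', ''h'', ''w''}"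

lemma scan_correct:
  assumes env: "row_loaded n a b x s" and u: "nats s ''u'' 0 = t" "t < n"
    and N: "N = selected n s - {t}"
  shows "halts_within scan s (200 * n + 60) (\<lambda>s'. keeps scan_vars s s' \<and>
    nats s' ''g'' 0 = cap a b 0 N \<and> nats s' ''h'' 0 = cap a b (a t) N \<and>
    nats s' ''l'' 0 = card N \<and> reals s' ''w'' 0 = sum x N)"
  unfolding scan_def
proof -
  define p where "p = nats s ''p''"
  have p: "bij_betw p {..<n} {..<n}" and mono: "\<And>i j. i < j \<Longrightarrow> j < n \<Longrightarrow> a (p i) \<le> a (p j)"
    using env by (auto simp: row_loaded_def sorts_def p_def)
  \<comment> \<open>The part of \<open>N\<close> among the \<open>j\<close> lightest columns. The
    next column weighs at least as much as each of these, which is the hypothesis of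
    \<open>cap_insert_largest\<close>.\<close>
  define L where "L j = N \<inter> p ` {..<j}" for j
  define I where "I j s' \<longleftrightarrow> keeps scan_vars s s' \<and>
    nats s' ''s'' 0 = sum a (L j) \<and>
    nats s' ''g'' 0 = cap a b 0 (L j) \<and> nats s' ''h'' 0 = cap a b (a t) (L j) \<and>
    nats s' ''l'' 0 = card (L j) \<and> reals s' ''w'' 0 = sum x (L j)" for j s'
  have fixed: "nats s' ''n'' 0 = n" "nats s' ''b'' 0 = b" "nats s' ''u'' 0 = t"
      "nats s' ''p'' = p" "nats s' ''G'' = nats s ''G''"
      "\<And>j. j < n \<Longrightarrow> nats s' ''a'' j = a j" "\<And>j. j < n \<Longrightarrow> reals s' ''x'' j = x j"
    if "keeps scan_vars s s'" for s'
    using env u that by (simp_all add: row_loaded_def keeps_def p_def)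
  let ?init = "Seq (Assign ''s'' (NConst 0)) (Seq (Assign ''l'' (NConst 0)) (Seq (Assign ''g'' (NConst 1))
      (Seq (RSet ''w'' (NConst 0) (ROfNat (NConst 0)))
        (Cond (NLess (Var ''b'') (NGet ''a'' (Var ''u''))) (Assign ''h'' (NConst 0)) (Assign ''h'' (NConst 1))))))"
  show "halts_within (Seq ?init (For ''j'' ''n'' scan_step)) s (200 * n + 60) (\<lambda>s'. keeps scan_vars s s' \<and>
    nats s' ''g'' 0 = cap a b 0 N \<and> nats s' ''h'' 0 = cap a b (a t) N \<and>
    nats s' ''l'' 0 = card N \<and> reals s' ''w'' 0 = sum x N)"
  proof (rule halts_seq)
    show "halts_within ?init s 40 (\<lambda>s'. I 0 (nset ''j'' 0 0 s'))"
      using fixed[of s] u by (intro halts_straight) (auto simp: I_def L_def cap_empty)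
  next
    fix s0 assume s0: "I 0 (nset ''j'' 0 0 s0)"
    show "halts_within (For ''j'' ''n'' scan_step) s0 (200 * n + 20) (\<lambda>s'. keeps scan_vars s s' \<and>
      nats s' ''g'' 0 = cap a b 0 N \<and> nats s' ''h'' 0 = cap a b (a t) N \<and>
      nats s' ''l'' 0 = card N \<and> reals s' ''w'' 0 = sum x N)"
    proof (rule halts_for[where I = I and M = n and B = 150])
      show "I 0 (nset ''j'' 0 0 s0)" by fact
      show "nats s' ''n'' 0 = n" if "I i s'" for i s' using that fixed by (simp add: I_def)
      have "L n = N" using p N by (auto simp: L_def bij_betw_def selected_def)
      then show "keeps scan_vars s s' \<and> nats s' ''g'' 0 = cap a b 0 N \<and> nats s' ''h'' 0 = cap a b (a t) N \<and>
        nats s' ''l'' 0 = card N \<and> reals s' ''w'' 0 = sum x N" if "I n s'" for s'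
        using that by (simp add: I_def)
      fix j s' assume I: "I j s'" and j: "j < n" "nats s' ''j'' 0 = j"
      have s': "keeps scan_vars s s'" using I by (simp add: I_def)
      have pj: "p j < n" using p j unfolding bij_betw_def by blast
      have step: "L (Suc j) = (if p j \<in> N then insert (p j) (L j) else L j)"
        by (auto simp: L_def lessThan_Suc)
      have fin: "finite (L j)" by (simp add: L_def)
      have new: "p j \<notin> L j" using p j unfolding L_def bij_betw_def inj_on_def by fastforce
      have max: "\<And>l. l \<in> L j \<Longrightarrow> a l \<le> a (p j)" using mono j by (auto simp: L_def)
      have mem: "p j \<in> N \<longleftrightarrow> nats s ''G'' (p j) \<noteq> 0 \<and> p j \<noteq> t"
        using pj N by (auto simp: selected_def)
      show "halts_within scan_step s' 150 (\<lambda>s'. nats s' ''j'' 0 = j \<and> I (Suc j) (nset ''j'' 0 (Suc j) s'))"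
      proof (rule halts_straight)
        show "straight scan_step" "steps scan_step \<le> 150" by (simp_all add: scan_step_def)
        show "nats (run scan_step s') ''j'' 0 = j \<and> I (Suc j) (nset ''j'' 0 (Suc j) (run scan_step s'))"
        proof (cases "p j \<in> N")
          case False
          then show ?thesis
            using I j mem fixed[OF s'] step by (auto simp: I_def scan_step_def)
        next
          case True
          then show ?thesis
            using I j mem fixed[OF s'] step pj u(2) fin new
              cap_insert_largest[where a = a, OF fin new, OF max, of b 0]
              cap_insert_largest[where a = a, OF fin new, OF max, of b "a t"]
            by (auto simp: I_def scan_step_def add_ac)
        qed
      qed
    qed simp
  qed simp
qed

section \<open>Testing one candidate set with one index \<open>t\<close>\<close>

definition reported ::
    "nat \<Rightarrow> nat \<Rightarrow> (nat \<Rightarrow> nat \<Rightarrow> nat) \<Rightarrow> (nat \<Rightarrow> nat) \<Rightarrow> (nat \<Rightarrow> real) \<Rightarrow> state \<Rightarrow> bool"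
  where "reported m n A d x s \<longleftrightarrow>
    (let r = nats s ''row'' 0; N = {j. j < n \<and> nats s ''N'' j \<noteq> 0};
         t = nats s ''t'' 0; k = nats s ''k'' 0
     in violated_gc m n A d x r N t k \<and> real (nats s ''rhs'' 0) = gc_rhs n (A r) (d r) N)"

text \<open>The search invariant: \<open>X\<close> collects what has been ruled out so far, and is
  asserted only while nothing has been found. After a find the recorded answer is asserted
  instead.\<close>

definition outcome ::
    "nat \<Rightarrow> nat \<Rightarrow> (nat \<Rightarrow> nat \<Rightarrow> nat) \<Rightarrow> (nat \<Rightarrow> nat) \<Rightarrow> (nat \<Rightarrow> real) \<Rightarrow> bool \<Rightarrow> state \<Rightarrow> bool"
  where "outcome m n A d x X s \<longleftrightarrow> (if nats s ''found'' 0 = 0 then X else reported m n A d x s)"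

abbreviation "report_vars \<equiv> {''found'', ''row'', ''t'', ''k'', ''rhs'', ''N''}"

lemma outcome_keeps:
  assumes "keeps W s s'" "W \<inter> report_vars = {}"
  shows "outcome m n A d x X s' \<longleftrightarrow> outcome m n A d x X s"
proof -
  have "nats s' v = nats s v" if "v \<in> report_vars" for v
    using assms that unfolding keeps_def by blast
  then show ?thesis by (simp add: outcome_def reported_def)
qed

lemma outcome_mono: "outcome m n A d x X s \<Longrightarrow> (X \<Longrightarrow> Y) \<Longrightarrow> outcome m n A d x Y s"
  by (auto simp: outcome_def)

text \<open>Repeated addition replaces the product with \<open>x t\<close>; the number of summands
  is the coefficient of \<open>x t\<close> for the smallest \<open>k\<close>.\<close>

definition add_multiple :: com
  where "add_multiple =
    Seq (Assign ''f'' (NSub (Var ''g'') (Var ''h'')))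
      (For ''j'' ''f'' (RSet ''w'' (NConst 0) (RAdd (RGet ''w'' (NConst 0)) (RGet ''x'' (Var ''u'')))))"

abbreviation "multiple_vars \<equiv> {''f'', ''j'', ''w''}"

lemma add_multiple_correct:
  assumes "nats s ''u'' 0 = t" "nats s ''g'' 0 - nats s ''h'' 0 \<le> M"
  shows "halts_within add_multiple s (30 * M + 20) (\<lambda>s'. keeps multiple_vars s s' \<and>
    reals s' ''w'' 0 = reals s ''w'' 0 + real (nats s ''g'' 0 - nats s ''h'' 0) * reals s ''x'' t)"
  unfolding add_multiple_def
proof (rule halts_seq)
  define K where "K = nats s ''g'' 0 - nats s ''h'' 0"
  define I where "I j s' \<longleftrightarrow> keeps multiple_vars s s' \<and> nats s' ''f'' 0 = K \<and>
    reals s' ''w'' 0 = reals s ''w'' 0 + real j * reals s ''x'' t" for j s'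
  show "halts_within (Assign ''f'' (NSub (Var ''g'') (Var ''h''))) s 10 (\<lambda>s'. I 0 (nset ''j'' 0 0 s'))"
    by (intro halts_straight) (auto simp: I_def K_def)
  fix s0 assume s0: "I 0 (nset ''j'' 0 0 s0)"
  show "halts_within (For ''j'' ''f'' (RSet ''w'' (NConst 0) (RAdd (RGet ''w'' (NConst 0)) (RGet ''x'' (Var ''u''))))) s0
      (30 * M + 10) (\<lambda>s'. keeps multiple_vars s s' \<and>
    reals s' ''w'' 0 = reals s ''w'' 0 + real (nats s ''g'' 0 - nats s ''h'' 0) * reals s ''x'' t)"
  proof (rule halts_for[where I = I and M = K and B = 10])
    show "I 0 (nset ''j'' 0 0 s0)" by fact
    show "K * (10 + 12) + 9 \<le> 30 * M + 10" using assms(2) by (simp add: K_def)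
    fix j s' assume I: "I j s'" and j: "j < K" "nats s' ''j'' 0 = j"
    have "nats s' ''u'' 0 = t" "reals s' ''x'' = reals s ''x''"
      using I assms(1) by (simp_all add: I_def keeps_def)
    then show "halts_within (RSet ''w'' (NConst 0) (RAdd (RGet ''w'' (NConst 0)) (RGet ''x'' (Var ''u'')))) s' 10
      (\<lambda>s'. nats s' ''j'' 0 = j \<and> I (Suc j) (nset ''j'' 0 (Suc j) s'))"
      using I j by (intro halts_straight) (auto simp: I_def algebra_simps)
  qed (auto simp: I_def K_def)
qed simp

definition report :: com
  where "report =
    Seq (Seq (Assign ''found'' (NConst 1)) (Seq (Assign ''row'' (Var ''r'')) (Seq (Assign ''t'' (Var ''u''))
      (Seq (Assign ''k'' (Var ''h'')) (Assign ''rhs'' (NSub (Var ''g'') (NConst 1)))))))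
    (Seq (For ''j'' ''n'' (NSet ''N'' (Var ''j'') (NGet ''G'' (Var ''j''))))
      (NSet ''N'' (Var ''u'') (NConst 0)))"

lemma report_correct:
  assumes n: "nats s ''n'' 0 = n" and u: "nats s ''u'' 0 = t" and N: "N = selected n s - {t}"
    and viol: "violated_gc m n A d x (nats s ''r'' 0) N t (nats s ''h'' 0)"
    and rhs: "real (nats s ''g'' 0 - 1) = gc_rhs n (A (nats s ''r'' 0)) (d (nats s ''r'' 0)) N"
  shows "halts_within report s (30 * n + 60) (\<lambda>s'. keeps (insert ''j'' report_vars) s s' \<and>
    outcome m n A d x X s')"
  unfolding report_def
proof (rule halts_seq)
  let ?W = "insert ''j'' report_vars"
  define I where "I j s' \<longleftrightarrow> keeps ?W s s' \<and> nats s' ''found'' 0 = 1 \<and>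
    nats s' ''row'' 0 = nats s ''r'' 0 \<and> nats s' ''t'' 0 = t \<and> nats s' ''k'' 0 = nats s ''h'' 0 \<and>
    nats s' ''rhs'' 0 = nats s ''g'' 0 - 1 \<and> (\<forall>i<j. nats s' ''N'' i = nats s ''G'' i)" for j s'
  let ?init = "Seq (Assign ''found'' (NConst 1)) (Seq (Assign ''row'' (Var ''r'')) (Seq (Assign ''t'' (Var ''u''))
      (Seq (Assign ''k'' (Var ''h'')) (Assign ''rhs'' (NSub (Var ''g'') (NConst 1))))))"
  show "halts_within ?init s 40 (\<lambda>s'. I 0 (nset ''j'' 0 0 s'))"
    using u by (intro halts_straight) (auto simp: I_def)
  fix s0 assume s0: "I 0 (nset ''j'' 0 0 s0)"
  show "halts_within (Seq (For ''j'' ''n'' (NSet ''N'' (Var ''j'') (NGet ''G'' (Var ''j''))))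
      (NSet ''N'' (Var ''u'') (NConst 0))) s0 (30 * n + 20) (\<lambda>s'. keeps ?W s s' \<and> outcome m n A d x X s')"
  proof (rule halts_seq)
    show "halts_within (For ''j'' ''n'' (NSet ''N'' (Var ''j'') (NGet ''G'' (Var ''j'')))) s0 (30 * n + 10) (I n)"
    proof (rule halts_for[where I = I and M = n and B = 10])
      show "I 0 (nset ''j'' 0 0 s0)" by fact
      show "nats s ''n'' 0 = n" if "I i s" for i s using that n by (simp add: I_def keeps_def)
      fix j s' assume I: "I j s'" and j: "j < n" "nats s' ''j'' 0 = j"
      have "nats s' ''G'' = nats s ''G''" using I by (simp add: I_def keeps_def)
      then show "halts_within (NSet ''N'' (Var ''j'') (NGet ''G'' (Var ''j''))) s' 10
          (\<lambda>s'. nats s' ''j'' 0 = j \<and> I (Suc j) (nset ''j'' 0 (Suc j) s'))"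
        using I j by (intro halts_straight) (auto simp: I_def less_Suc_eq)
    qed auto
    fix s' assume I: "I n s'"
    have t: "nats s' ''u'' 0 = t" using I u by (simp add: I_def keeps_def)
    \<comment> \<open>The copied marks may include \<open>t\<close>; clearing this entry leaves
      exactly \<open>N\<close>.\<close>
    define s2 where "s2 = nset ''N'' t 0 s'"
    have N2: "{j. j < n \<and> nats s2 ''N'' j \<noteq> 0} = N"
      using I N by (auto simp: I_def selected_def s2_def)
    have vals: "nats s2 ''found'' 0 = 1" "nats s2 ''row'' 0 = nats s ''r'' 0" "nats s2 ''t'' 0 = t"
        "nats s2 ''k'' 0 = nats s ''h'' 0" "nats s2 ''rhs'' 0 = nats s ''g'' 0 - 1"
      using I by (simp_all add: I_def s2_def)
    have "outcome m n A d x X s2"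
      unfolding outcome_def reported_def Let_def vals N2 using viol rhs by simp
    moreover have "keeps ?W s s2" using I by (simp add: I_def s2_def)
    ultimately show "halts_within (NSet ''N'' (Var ''u'') (NConst 0)) s' 10
        (\<lambda>s'. keeps ?W s s' \<and> outcome m n A d x X s')"
      using t by (intro halts_straight) (simp_all add: s2_def)
  qed auto
qed simp

text \<open>After \<open>add_multiple\<close>, the comparison \<open>g < w + 1\<close> says that the
  excess is positive. A set flag \<open>found\<close> skips everything, which protects the first
  recorded answer.\<close>

definition test :: com
  where "test =
    Cond (NLess (NConst 0) (Var ''found'')) Skip
      (Seq scan (Seq add_multiple
        (Cond (BAnd (BNot (NLess (Var ''l'') (Var ''h'')))
            (RLess (ROfNat (Var ''g'')) (RAdd (RGet ''w'' (NConst 0)) (ROfNat (NConst 1)))))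
          report Skip)))"

abbreviation "test_vars \<equiv> scan_vars \<union> multiple_vars \<union> report_vars"

lemma test_correct:
  assumes env: "row_loaded n (A r) (d r) x s" and r: "nats s ''r'' 0 = r" "r < m"
    and u: "nats s ''u'' 0 = t" "t < n" and N: "N = selected n s - {t}"
    and out: "outcome m n A d x X s"
  shows "halts_within test s (300 * n + 300) (\<lambda>s'. keeps test_vars s s' \<and>
    outcome m n A d x (X \<and> \<not> separates (A r) (d r) x t N) s')"
  unfolding test_def
proof (rule halts_cond)
  assume "bval (NLess (NConst 0) (Var ''found'')) s"
  then show "halts_within Skip s (300 * n + 290) (\<lambda>s'. keeps test_vars s s' \<and>
    outcome m n A d x (X \<and> \<not> separates (A r) (d r) x t N) s')"
    using out by (intro halts_straight) (auto simp: outcome_def)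
next
  assume "\<not> bval (NLess (NConst 0) (Var ''found'')) s"
  let ?g = "cap (A r) (d r) 0 N" and ?h = "cap (A r) (d r) (A r t) N"
  have Nn: "N \<subseteq> {..<n}" "t \<notin> N" using N by (auto simp: selected_def)
  have fin: "finite N" using Nn(1) by (rule finite_subset) simp
  \<comment> \<open>As \<open>N\<close> misses \<open>t\<close>, its capacity is at most
    \<open>n\<close>, so the repeated addition stays linear in \<open>n\<close>. With
    \<open>?h \<le> ?g\<close> the truncated subtraction is exact.\<close>
  have "N \<subseteq> {..<n} - {t}" using Nn by auto
  then have "card N \<le> n - 1" using card_mono[of "{..<n} - {t}" N] u(2) by simp
  then have g: "?g \<le> n" using cap_le_card[OF fin, of "A r" "d r" 0] u(2) by simp
  have hg: "?h \<le> ?g" using fin by (intro cap_antimono) auto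
  show "halts_within (Seq scan (Seq add_multiple
        (Cond (BAnd (BNot (NLess (Var ''l'') (Var ''h'')))
            (RLess (ROfNat (Var ''g'')) (RAdd (RGet ''w'' (NConst 0)) (ROfNat (NConst 1)))))
          report Skip))) s (300 * n + 290) (\<lambda>s'. keeps test_vars s s' \<and>
    outcome m n A d x (X \<and> \<not> separates (A r) (d r) x t N) s')"
  proof (rule halts_seq[OF scan_correct[OF env u N]])
    fix s1 assume s1: "keeps scan_vars s s1 \<and> nats s1 ''g'' 0 = ?g \<and> nats s1 ''h'' 0 = ?h \<and>
      nats s1 ''l'' 0 = card N \<and> reals s1 ''w'' 0 = sum x N"
    have u1: "nats s1 ''u'' 0 = t" using s1 u by (simp add: keeps_def)
    have "nats s1 ''g'' 0 - nats s1 ''h'' 0 \<le> n" using s1 g by simp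
    from add_multiple_correct[OF u1 this]
    show "halts_within (Seq add_multiple
        (Cond (BAnd (BNot (NLess (Var ''l'') (Var ''h'')))
            (RLess (ROfNat (Var ''g'')) (RAdd (RGet ''w'' (NConst 0)) (ROfNat (NConst 1)))))
          report Skip)) s1 (100 * n + 200) (\<lambda>s'. keeps test_vars s s' \<and>
    outcome m n A d x (X \<and> \<not> separates (A r) (d r) x t N) s')"
    proof (rule halts_seq)
      fix s2 assume s2: "keeps multiple_vars s1 s2 \<and>
        reals s2 ''w'' 0 = reals s1 ''w'' 0 + real (nats s1 ''g'' 0 - nats s1 ''h'' 0) * reals s1 ''x'' t"
      have k: "keeps (scan_vars \<union> multiple_vars) s s2"
        by (rule keeps_trans[OF conjunct1[OF s1] conjunct1[OF s2]]) auto
      have x1: "reals s1 ''x'' t = x t" using s1 env u(2) by (simp add: keeps_def row_loaded_def)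
      have vals: "nats s2 ''g'' 0 = ?g" "nats s2 ''h'' 0 = ?h" "nats s2 ''l'' 0 = card N"
        using s1 s2 by (simp_all add: keeps_def)
      have w: "reals s2 ''w'' 0 = sum x N + (real ?g - real ?h) * x t"
        using s1 s2 x1 hg by (simp add: of_nat_diff)
      have fixed: "nats s2 ''n'' 0 = n" "nats s2 ''u'' 0 = t" "nats s2 ''r'' 0 = r" "selected n s2 = selected n s"
        using k env u r by (simp_all add: keeps_def row_loaded_def selected_def)
      have out2: "outcome m n A d x X s2" using outcome_keeps[OF k] out by simp
      have sep: "bval (BAnd (BNot (NLess (Var ''l'') (Var ''h'')))
          (RLess (ROfNat (Var ''g'')) (RAdd (RGet ''w'' (NConst 0)) (ROfNat (NConst 1))))) s2
        \<longleftrightarrow> separates (A r) (d r) x t N"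
        by (auto simp: vals w separates_def excess_def)
      show "halts_within (Cond (BAnd (BNot (NLess (Var ''l'') (Var ''h'')))
            (RLess (ROfNat (Var ''g'')) (RAdd (RGet ''w'' (NConst 0)) (ROfNat (NConst 1)))))
          report Skip) s2 (70 * n + 100) (\<lambda>s'. keeps test_vars s s' \<and>
        outcome m n A d x (X \<and> \<not> separates (A r) (d r) x t N) s')"
      proof (rule halts_cond, unfold sep)
        assume "separates (A r) (d r) x t N"
        then have "violated_gc m n A d x r N t ?h"
          using separates_iff[OF Nn(1) u(2) Nn(2), of "A r" "d r" x] r(2) by (simp add: violated_gc_def)
        moreover have "real (?g - 1) = gc_rhs n (A r) (d r) N"
          using cap_pos[OF fin, of "A r" "d r"] by (simp add: gc_rhs_eq[OF Nn(1)] of_nat_diff)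
        ultimately have "halts_within report s2 (30 * n + 60) (\<lambda>s'. keeps (insert ''j'' report_vars) s2 s' \<and>
          outcome m n A d x (X \<and> \<not> separates (A r) (d r) x t N) s')"
          using fixed N by (intro report_correct[where t = t and N = N]) (simp_all add: vals)
        then show "halts_within report s2 (70 * n + 60) (\<lambda>s'. keeps test_vars s s' \<and>
          outcome m n A d x (X \<and> \<not> separates (A r) (d r) x t N) s')"
        proof (rule halts_conseq)
          fix s' assume s': "keeps (insert ''j'' report_vars) s2 s' \<and>
            outcome m n A d x (X \<and> \<not> separates (A r) (d r) x t N) s'"
          have "keeps test_vars s s'" by (rule keeps_trans[OF k conjunct1[OF s']]) auto
          with s' show "keeps test_vars s s' \<and> outcome m n A d x (X \<and> \<not> separates (A r) (d r) x t N) s'"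
            by blast
        qed simp
      next
        assume "\<not> separates (A r) (d r) x t N"
        moreover have "keeps test_vars s s2" using k by (rule keeps_mono) auto
        ultimately show "halts_within Skip s2 (70 * n + 60) (\<lambda>s'. keeps test_vars s s' \<and>
          outcome m n A d x (X \<and> \<not> separates (A r) (d r) x t N) s')"
          using out2 by (intro halts_straight) (auto simp: outcome_def)
      qed simp
    qed simp
  qed simp
qed simp

definition test_all :: com
  where "test_all = For ''u'' ''n'' test"

lemma test_all_correct:
  assumes env: "row_loaded n (A r) (d r) x s" and r: "nats s ''r'' 0 = r" "r < m"
    and out: "outcome m n A d x X s"
  shows "halts_within test_all s (n * (300 * n + 320) + 10) (\<lambda>s'. keeps (insert ''u'' test_vars) s s' \<and>
    outcome m n A d x (X \<and> (\<forall>t<n. \<not> separates (A r) (d r) x t (selected n s - {t}))) s')"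
  unfolding test_all_def
proof (rule halts_for[where M = n and B = "300 * n + 300" and I = "\<lambda>i s'. keeps (insert ''u'' test_vars) s s' \<and>
    outcome m n A d x (X \<and> (\<forall>t<i. \<not> separates (A r) (d r) x t (selected n s - {t}))) s'"])
  have u: "outcome m n A d x Y (nset ''u'' i e s') = outcome m n A d x Y s'" for Y i e s'
    by (rule outcome_keeps[of "{''u''}"]) auto
  show "keeps (insert ''u'' test_vars) s (nset ''u'' 0 0 s) \<and>
    outcome m n A d x (X \<and> (\<forall>t<0. \<not> separates (A r) (d r) x t (selected n s - {t}))) (nset ''u'' 0 0 s)"
    using out by (simp add: u)
  fix i s'
  assume I: "keeps (insert ''u'' test_vars) s s' \<and>
    outcome m n A d x (X \<and> (\<forall>t<i. \<not> separates (A r) (d r) x t (selected n s - {t}))) s'"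
  show "nats s' ''n'' 0 = n" using I env by (simp add: row_loaded_def keeps_def)
  assume i: "i < n" "nats s' ''u'' 0 = i"
  have sel: "selected n s' = selected n s" using I by (simp add: selected_def keeps_def)
  have "row_loaded n (A r) (d r) x s'" using I by (intro row_loaded_keeps[OF env]) auto
  moreover have "nats s' ''r'' 0 = r" using I r by (simp add: keeps_def)
  ultimately have "halts_within test s' (300 * n + 300) (\<lambda>s''. keeps test_vars s' s'' \<and>
    outcome m n A d x ((X \<and> (\<forall>t<i. \<not> separates (A r) (d r) x t (selected n s - {t}))) \<and>
      \<not> separates (A r) (d r) x i (selected n s - {i})) s'')"
    using I i r(2) sel by (intro test_correct) auto
  then show "halts_within test s' (300 * n + 300) (\<lambda>s'. nats s' ''u'' 0 = i \<and>
      keeps (insert ''u'' test_vars) s (nset ''u'' 0 (Suc i) s') \<and>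
      outcome m n A d x (X \<and> (\<forall>t<Suc i. \<not> separates (A r) (d r) x t (selected n s - {t})))
        (nset ''u'' 0 (Suc i) s'))"
  proof (rule halts_conseq)
    fix s'' assume s'': "keeps test_vars s' s'' \<and>
      outcome m n A d x ((X \<and> (\<forall>t<i. \<not> separates (A r) (d r) x t (selected n s - {t}))) \<and>
      \<not> separates (A r) (d r) x i (selected n s - {i})) s''"
    have "keeps (insert ''u'' test_vars) s s''"
      by (rule keeps_trans[OF conjunct1[OF I] conjunct1[OF s'']]) auto
    moreover have "nats s'' ''u'' 0 = i" using s'' i by (simp add: keeps_def)
    moreover have "outcome m n A d x (X \<and> (\<forall>t<Suc i. \<not> separates (A r) (d r) x t (selected n s - {t}))) s''"
      using s'' by (elim conjE outcome_mono) (auto simp: less_Suc_eq)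
    ultimately show "nats s'' ''u'' 0 = i \<and> keeps (insert ''u'' test_vars) s (nset ''u'' 0 (Suc i) s'') \<and>
      outcome m n A d x (X \<and> (\<forall>t<Suc i. \<not> separates (A r) (d r) x t (selected n s - {t})))
        (nset ''u'' 0 (Suc i) s'')" by (simp add: u)
  qed simp
qed (auto simp: algebra_simps)

section \<open>Enumerating the fractional subsets with a binary counter\<close>

definition fractional :: "nat \<Rightarrow> (nat \<Rightarrow> real) \<Rightarrow> nat set"
  where "fractional n x = {i. i < n \<and> 0 < x i \<and> x i < 1}"

lemma finite_fractional [simp]: "finite (fractional n x)"
  by (simp add: fractional_def)

lemma selected_nset:
  "selected n (nset v i e s) =
    (if v = ''G'' then (if e = 0 then selected n s - {i} else selected n s \<union> ({i} \<inter> {..<n}))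
     else selected n s)"
  by (auto simp: selected_def)

lemma outcome_nset: "v \<notin> report_vars \<Longrightarrow> outcome m n A d x X (nset v i e s) = outcome m n A d x X s"
  by (rule outcome_keeps[of "{v}"]) auto

text \<open>Only fractional positions act as digits, so the marks at positions with
  \<open>x i = 1\<close> persist through all increments. A zero digit absorbs the carry.\<close>

definition carry_step :: com
  where "carry_step =
    Cond (BAnd (NLess (NConst 0) (Var ''y''))
        (BAnd (RLess (ROfNat (NConst 0)) (RGet ''x'' (Var ''i''))) (RLess (RGet ''x'' (Var ''i'')) (ROfNat (NConst 1)))))
      (Cond (NLess (NConst 0) (NGet ''G'' (Var ''i'')))
        (NSet ''G'' (Var ''i'') (NConst 0))
        (Seq (NSet ''G'' (Var ''i'') (NConst 1)) (Assign ''y'' (NConst 0))))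
      Skip"

text \<open>Binary increment of the bits \<open>G\<close> at the fractional positions, with carry \<open>y\<close>.\<close>

definition increment :: com
  where "increment =
    Seq (Assign ''y'' (NConst 1)) (Seq (For ''i'' ''n'' carry_step)
      (Assign ''more'' (NSub (NConst 1) (Var ''y''))))"

abbreviation "increment_vars \<equiv> {''y'', ''i'', ''G'', ''more''}"

definition binary_succ :: "nat set \<Rightarrow> nat set \<Rightarrow> nat set \<Rightarrow> bool"
  where "binary_succ F S T \<longleftrightarrow>
    (\<exists>i. i \<in> F \<and> i \<notin> S \<and> F \<inter> {..<i} \<subseteq> S \<and> T = insert i (S - F \<inter> {..<i}))"

text \<open>A carry that survives all positions shows that every fractional digit was set, that is,
  the last subset has been reached; \<open>more\<close> is then 0 and ends the enumeration.\<close>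

lemma increment_correct:
  assumes n: "nats s ''n'' 0 = n" and x: "\<forall>i<n. reals s ''x'' i = x i"
    and F: "F = fractional n x" and S: "S = selected n s"
  shows "halts_within increment s (60 * n + 20) (\<lambda>s'. keeps increment_vars s s' \<and>
    (if nats s' ''more'' 0 = 0 then F \<subseteq> S
     else binary_succ F S (selected n s')))"
  unfolding increment_def
proof (rule halts_seq)
  \<comment> \<open>Either the carry is still pending, and the fractional positions passed were all
    set and are now cleared, or it has been absorbed and the successor is complete.\<close>
  define I where "I j s' \<longleftrightarrow> keeps increment_vars s s' \<and>
    (nats s' ''y'' 0 = 1 \<and> F \<inter> {..<j} \<subseteq> S \<and> selected n s' = S - F \<inter> {..<j} \<or>
     nats s' ''y'' 0 = 0 \<and> binary_succ F S (selected n s'))" for j s'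
  show "halts_within (Assign ''y'' (NConst 1)) s 3 (\<lambda>s'. I 0 (nset ''i'' 0 0 s'))"
    by (intro halts_straight) (auto simp: I_def S selected_nset)
  fix s0 assume s0: "I 0 (nset ''i'' 0 0 s0)"
  let ?Q = "\<lambda>s'. keeps increment_vars s s' \<and>
    (if nats s' ''more'' 0 = 0 then F \<subseteq> S
     else binary_succ F S (selected n s'))"
  show "halts_within (Seq (For ''i'' ''n'' carry_step) (Assign ''more'' (NSub (NConst 1) (Var ''y''))))
      s0 (60 * n + 17) ?Q"
  proof (rule halts_seq)
    show "halts_within (For ''i'' ''n'' carry_step) s0 (60 * n + 9) (I n)"
    proof (rule halts_for[where I = I and M = n and B = 40])
      show "I 0 (nset ''i'' 0 0 s0)" by fact
      show "nats s' ''n'' 0 = n" if "I i s'" for i s' using that n by (simp add: I_def keeps_def)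
      fix j s' assume I: "I j s'" and j: "j < n" "nats s' ''i'' 0 = j"
      have xj: "reals s' ''x'' j = x j" using I x j by (simp add: I_def keeps_def)
      have Fj: "j \<in> F \<longleftrightarrow> 0 < x j \<and> x j < 1" using j by (simp add: F fractional_def)
      have Gj: "nats s' ''G'' j = 0 \<longleftrightarrow> j \<notin> selected n s'" using j by (simp add: selected_def)
      have FSuc: "F \<inter> {..<Suc j} = (if j \<in> F then insert j (F \<inter> {..<j}) else F \<inter> {..<j})"
        by (auto simp: less_Suc_eq)
      have keep: "keeps increment_vars s s'" using I by (simp add: I_def)
      show "halts_within carry_step s' 40 (\<lambda>s'. nats s' ''i'' 0 = j \<and> I (Suc j) (nset ''i'' 0 (Suc j) s'))"
      proof (rule halts_straight)
        show "straight carry_step" "steps carry_step \<le> 40" by (simp_all add: carry_step_def)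
        show "nats (run carry_step s') ''i'' 0 = j \<and> I (Suc j) (nset ''i'' 0 (Suc j) (run carry_step s'))"
        proof (cases "nats s' ''y'' 0 = 0")
          case True
          then have "binary_succ F S (selected n s')" using I by (simp add: I_def)
          with True show ?thesis using keep j by (simp add: I_def carry_step_def selected_nset)
        next
          case y: False
          then have st: "nats s' ''y'' 0 = 1" "F \<inter> {..<j} \<subseteq> S" "selected n s' = S - F \<inter> {..<j}"
            using I y by (simp_all add: I_def)
          show ?thesis
          proof (cases "j \<in> F")
            case False
            then have "F \<inter> {..<Suc j} = F \<inter> {..<j}" using FSuc by simp
            moreover have "\<not> (0 < x j \<and> x j < 1)" using False Fj by simp
            ultimately show ?thesis
              using keep st j xj by (simp add: I_def carry_step_def selected_nset) blast
          next
            case jF: True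
            show ?thesis
            proof (cases "j \<in> S")
              case True
              then have "0 < nats s' ''G'' j" using Gj st by auto
              moreover have "F \<inter> {..<Suc j} \<subseteq> S" "S - F \<inter> {..<j} - {j} = S - F \<inter> {..<Suc j}"
                using True st FSuc jF by auto
              ultimately show ?thesis
                using keep st j xj Fj jF by (simp add: I_def carry_step_def selected_nset)
            next
              case False
              then have "nats s' ''G'' j = 0" using Gj st by auto
              moreover have "(S - F \<inter> {..<j}) \<union> {j} \<inter> {..<n} = insert j (S - F \<inter> {..<j})"
                using j by auto
              moreover have "binary_succ F S (insert j (S - F \<inter> {..<j}))"
                unfolding binary_succ_def using st False jF by (intro exI[of _ j] conjI) simp_all
              ultimately show ?thesis
                using keep st j xj Fj jF by (simp add: I_def carry_step_def selected_nset)
            qed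
          qed
        qed
      qed
    qed auto
    fix s' assume I: "I n s'"
    have "F \<inter> {..<n} = F" by (auto simp: F fractional_def)
    then have "keeps increment_vars s s' \<and>
        (nats s' ''y'' 0 = 1 \<and> F \<subseteq> S \<or> nats s' ''y'' 0 = 0 \<and> binary_succ F S (selected n s'))"
      using I unfolding I_def by metis
    then show "halts_within (Assign ''more'' (NSub (NConst 1) (Var ''y''))) s' 8 ?Q"
      by (intro halts_straight) (simp_all add: selected_nset, elim conjE disjE, simp_all)
  qed simp
qed simp

definition enumerate_subsets :: com
  where "enumerate_subsets = While (NLess (NConst 0) (Var ''more'')) (Seq test_all increment)"

abbreviation "enumerate_vars \<equiv> insert ''u'' test_vars \<union> increment_vars"

text \<open>Rounds are counted by the code of the current set: it starts at 0, rises by one with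
  each increment and stays below \<open>2 ^ card F\<close>, which bounds the number of
  rounds.\<close>

lemma enumerate_subsets_correct:
  assumes env: "row_loaded n (A r) (d r) x s" and r: "nats s ''r'' 0 = r" "r < m"
    and O: "selected n s = {i. i < n \<and> x i = 1}" and more: "nats s ''more'' 0 = 1"
    and out: "outcome m n A d x X s" and F: "F = fractional n x"
  shows "halts_within enumerate_subsets s (2 ^ card F * (300 * n * n + 380 * n + 40) + 10)
    (\<lambda>s'. keeps enumerate_vars s s' \<and> outcome m n A d x (X \<and>
      (\<forall>G\<subseteq>F. \<forall>t<n. \<not> separates (A r) (d r) x t ({i. i < n \<and> x i = 1} \<union> G - {t}))) s')"
proof -
  let ?O = "{i. i < n \<and> x i = 1}"
  define clear where "clear G \<longleftrightarrow> (\<forall>t<n. \<not> separates (A r) (d r) x t (?O \<union> G - {t}))" for G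
  \<comment> \<open>The family \<open>V\<close> of sets already tested is known only through its
    codes, which cover everything below the code \<open>k\<close> of the current set.\<close>
  define J where "J k s' \<longleftrightarrow> keeps enumerate_vars s s' \<and>
    (\<exists>V\<subseteq>Pow F. outcome m n A d x (X \<and> (\<forall>G\<in>V. clear G)) s' \<and> {..<k} \<subseteq> subset_code F ` V \<and>
      (if nats s' ''more'' 0 = 0 then V = Pow F
       else \<exists>G\<subseteq>F. selected n s' = ?O \<union> G \<and> subset_code F G = k))" for k s'
  have finF: "finite F" and disj: "?O \<inter> F = {}" by (auto simp: F fractional_def)
  have "halts_within enumerate_subsets s (2 ^ card F * (300 * n * n + 380 * n + 40) + 10)
    (\<lambda>s'. keeps enumerate_vars s s' \<and> outcome m n A d x (X \<and> (\<forall>G\<subseteq>F. clear G)) s')"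
    unfolding enumerate_subsets_def
  proof (rule halts_while[where I = J and M = "2 ^ card F" and B = "300 * n * n + 380 * n + 30"])
    have "\<exists>G\<subseteq>F. selected n s = ?O \<union> G \<and> subset_code F G = 0"
      using O by (intro exI[of _ "{}"]) (auto simp: subset_code_def)
    then show "J 0 s"
      unfolding J_def using out more by (intro conjI exI[of _ "{}"]) auto
  next
    fix k s' assume J: "J k s'" and "\<not> bval (NLess (NConst 0) (Var ''more'')) s'"
    then have "keeps enumerate_vars s s'" "outcome m n A d x (X \<and> (\<forall>G\<in>Pow F. clear G)) s'"
      by (auto simp: J_def)
    then show "keeps enumerate_vars s s' \<and> outcome m n A d x (X \<and> (\<forall>G\<subseteq>F. clear G)) s'"
      by (simp add: Ball_def)
  next
    fix k s' assume J: "J k s'" and more: "bval (NLess (NConst 0) (Var ''more'')) s'"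
    obtain V G where V: "V \<subseteq> Pow F" "outcome m n A d x (X \<and> (\<forall>G\<in>V. clear G)) s'"
        "{..<k} \<subseteq> subset_code F ` V"
      and G: "G \<subseteq> F" "selected n s' = ?O \<union> G" "subset_code F G = k"
      using J more unfolding J_def by auto
    have keep: "keeps enumerate_vars s s'" using J by (simp add: J_def)
    have env': "row_loaded n (A r) (d r) x s'" using keep by (rule row_loaded_keeps[OF env]) auto
    have r': "nats s' ''r'' 0 = r" using keep r by (simp add: keeps_def)
    have codes: "{..<Suc k} \<subseteq> subset_code F ` insert G V" using V G by (auto simp: lessThan_Suc)
    have "halts_within (Seq test_all increment) s' (300 * n * n + 380 * n + 30) (J (Suc k))"
    proof (rule halts_seq[OF test_all_correct[OF env' r' r(2) V(2)]])
      fix s1 assume s1: "keeps (insert ''u'' test_vars) s' s1 \<and>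
        outcome m n A d x ((X \<and> (\<forall>G\<in>V. clear G)) \<and>
          (\<forall>t<n. \<not> separates (A r) (d r) x t (selected n s' - {t}))) s1"
      have keep1: "keeps enumerate_vars s s1"
        by (rule keeps_trans[OF keep conjunct1[OF s1]]) auto
      have out1: "outcome m n A d x (X \<and> (\<forall>G\<in>insert G V. clear G)) s1"
        using s1 G(2) by (elim conjE outcome_mono) (auto simp: clear_def)
      have n1: "nats s1 ''n'' 0 = n" "\<forall>i<n. reals s1 ''x'' i = x i"
        using env keep1 by (simp_all add: row_loaded_def keeps_def)
      have sel1: "?O \<union> G = selected n s1"
        using s1 G(2) by (simp add: keeps_def selected_def)
      show "halts_within increment s1 (60 * n + 20) (J (Suc k))"
      proof (rule halts_conseq[OF increment_correct[OF n1 F sel1]])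
        fix s2 assume s2: "keeps increment_vars s1 s2 \<and>
          (if nats s2 ''more'' 0 = 0 then F \<subseteq> ?O \<union> G
           else binary_succ F (?O \<union> G) (selected n s2))"
        have keep2: "keeps enumerate_vars s s2"
          by (rule keeps_trans[OF keep1 conjunct1[OF s2]]) auto
        have out2: "outcome m n A d x (X \<and> (\<forall>G\<in>insert G V. clear G)) s2"
          using out1 s2 outcome_keeps[of increment_vars s1 s2] by simp
        have sub: "insert G V \<subseteq> Pow F" using V G by auto
        have "if nats s2 ''more'' 0 = 0 then insert G V = Pow F
          else \<exists>G'\<subseteq>F. selected n s2 = ?O \<union> G' \<and> subset_code F G' = Suc k"
        proof (cases "nats s2 ''more'' 0 = 0")
          case True
          \<comment> \<open>The overflow occurs at the full set, whose code is the largest possible,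
            so the tested family has all codes and is \<open>Pow F\<close>.\<close>
          then have "G = F" using s2 G(1) disj by auto
          then have "Suc k = 2 ^ card F" using subset_code_top[OF finF] G(3) by simp
          then show ?thesis using Pow_if_all_codes[OF finF sub] codes True by simp
        next
          case False
          then obtain i where i: "i \<in> F" "i \<notin> ?O \<union> G" "F \<inter> {..<i} \<subseteq> ?O \<union> G"
              "selected n s2 = insert i (?O \<union> G - F \<inter> {..<i})"
            using s2 unfolding binary_succ_def by (metis (no_types, lifting))
          have "F \<inter> {..<i} \<subseteq> G" using i(3) disj by auto
          then have "subset_code F (insert i (G - {..<i})) = Suc k"
            using subset_code_succ[OF finF G(1) i(1)] i(2) G(3) by simp
          moreover have "selected n s2 = ?O \<union> insert i (G - {..<i})"
            using i(4) G(1) disj by auto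
          moreover have "insert i (G - {..<i}) \<subseteq> F" using G(1) i(1) by auto
          ultimately have "\<exists>G'\<subseteq>F. selected n s2 = ?O \<union> G' \<and> subset_code F G' = Suc k"
            by blast
          then show ?thesis using False by simp
        qed
        then show "J (Suc k) s2" unfolding J_def using keep2 out2 codes sub by blast
      qed simp
    qed (simp add: algebra_simps)
    then show "k < 2 ^ card F \<and> halts_within (Seq test_all increment) s' (300 * n * n + 380 * n + 30) (J (Suc k))"
      using subset_code_less[OF finF G(1)] G(3) by simp
  qed (simp, rule trans_le_add2, rule mult_le_mono2, simp)
  then show ?thesis by (simp add: clear_def)
qed

section \<open>Sorting one row by counting ranks\<close>

lemma sort_rank_Suc:
  "sort_rank a (Suc j) i = sort_rank a j i + (if a j < a i \<or> a j = a i \<and> j < i then 1 else 0)"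
proof -
  let ?P = "\<lambda>j. a j < a i \<or> a j = a i \<and> j < i"
  have "{k. k < Suc j \<and> ?P k} = (if ?P j then insert j {k. k < j \<and> ?P k} else {k. k < j \<and> ?P k})"
    by (auto simp: less_Suc_eq)
  then show ?thesis by (simp add: sort_rank_def)
qed

text \<open>Nested conditionals stand for the disjunction in \<open>sort_rank\<close>. In the second
  one, \<open>a j < a i\<close> is already excluded, so the negated comparison means
  equality.\<close>

definition rank_step :: com
  where "rank_step =
    Cond (NLess (NGet ''a'' (Var ''j'')) (NGet ''a'' (Var ''i''))) (Inc ''q'')
      (Cond (BAnd (BNot (NLess (NGet ''a'' (Var ''i'')) (NGet ''a'' (Var ''j'')))) (NLess (Var ''j'') (Var ''i'')))
        (Inc ''q'') Skip)"

definition sort_row :: com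
  where "sort_row = For ''i'' ''n''
    (Seq (Assign ''q'' (NConst 0)) (Seq (For ''j'' ''n'' rank_step) (NSet ''p'' (Var ''q'') (Var ''i''))))"

abbreviation "sort_vars \<equiv> {''i'', ''j'', ''q'', ''p''}"

lemma sort_row_correct:
  assumes n: "nats s ''n'' 0 = n" and a: "\<forall>j<n. nats s ''a'' j = a j"
  shows "halts_within sort_row s (n * (50 * n + 40) + 9)
    (\<lambda>s'. keeps sort_vars s s' \<and> sorts (nats s' ''p'') a n)"
  unfolding sort_row_def
proof -
  define I where "I i s' \<longleftrightarrow> keeps sort_vars s s' \<and> (\<forall>i'<i. i' < n \<longrightarrow> nats s' ''p'' (sort_rank a n i') = i')" for i s'
  have fixed: "nats s' ''n'' 0 = n" "\<forall>j<n. nats s' ''a'' j = a j" if "keeps sort_vars s s'" for s'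
    using that n a by (simp_all add: keeps_def)
  show "halts_within (For ''i'' ''n'' (Seq (Assign ''q'' (NConst 0))
      (Seq (For ''j'' ''n'' rank_step) (NSet ''p'' (Var ''q'') (Var ''i''))))) s (n * (50 * n + 40) + 9)
    (\<lambda>s'. keeps sort_vars s s' \<and> sorts (nats s' ''p'') a n)"
  proof (rule halts_for[where I = I and M = n and B = "50 * n + 20"])
    show "I 0 (nset ''i'' 0 0 s)" by (simp add: I_def)
    show "nats s' ''n'' 0 = n" if "I i s'" for i s' using that fixed by (simp add: I_def)
    show "keeps sort_vars s s' \<and> sorts (nats s' ''p'') a n" if "I n s'" for s'
      using that by (auto simp: I_def intro: sorts_inverse_sort_rank)
    fix i s' assume I: "I i s'" and i: "i < n" "nats s' ''i'' 0 = i"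
    define K where "K j s'' \<longleftrightarrow> keeps sort_vars s s'' \<and> nats s'' ''p'' = nats s' ''p'' \<and>
      nats s'' ''i'' 0 = i \<and> nats s'' ''q'' 0 = sort_rank a j i" for j s''
    show "halts_within (Seq (Assign ''q'' (NConst 0)) (Seq (For ''j'' ''n'' rank_step)
        (NSet ''p'' (Var ''q'') (Var ''i'')))) s' (50 * n + 20)
      (\<lambda>s'. nats s' ''i'' 0 = i \<and> I (Suc i) (nset ''i'' 0 (Suc i) s'))"
    proof (rule halts_seq)
      show "halts_within (Assign ''q'' (NConst 0)) s' 3 (\<lambda>s''. K 0 (nset ''j'' 0 0 s''))"
        using I i by (intro halts_straight) (auto simp: K_def I_def sort_rank_def)
      fix s0 assume s0: "K 0 (nset ''j'' 0 0 s0)"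
      show "halts_within (Seq (For ''j'' ''n'' rank_step) (NSet ''p'' (Var ''q'') (Var ''i''))) s0 (50 * n + 17)
        (\<lambda>s'. nats s' ''i'' 0 = i \<and> I (Suc i) (nset ''i'' 0 (Suc i) s'))"
      proof (rule halts_seq)
        show "halts_within (For ''j'' ''n'' rank_step) s0 (50 * n + 9) (K n)"
        proof (rule halts_for[where I = K and M = n and B = 32])
          show "K 0 (nset ''j'' 0 0 s0)" by fact
          show "nats s' ''n'' 0 = n" if "K i s'" for i s' using that fixed by (simp add: K_def)
          fix j s'' assume K: "K j s''" and j: "j < n" "nats s'' ''j'' 0 = j"
          have "nats s'' ''a'' j = a j" "nats s'' ''a'' i = a i" using K fixed i j by (auto simp: K_def)
          then show "halts_within rank_step s'' 32 (\<lambda>s'. nats s' ''j'' 0 = j \<and> K (Suc j) (nset ''j'' 0 (Suc j) s'))"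
            using K j by (intro halts_straight) (auto simp: rank_step_def K_def sort_rank_Suc)
        qed auto
        fix s'' assume K: "K n s''"
        \<comment> \<open>Ranks are distinct, so this write does not overwrite an earlier entry of
          \<open>p\<close>.\<close>
        have "sort_rank a n i' \<noteq> sort_rank a n i" if "i' < i" for i'
          using sort_rank_bij[of a n] that i(1) unfolding bij_betw_def inj_on_def by fastforce
        then show "halts_within (NSet ''p'' (Var ''q'') (Var ''i'')) s'' 8
            (\<lambda>s'. nats s' ''i'' 0 = i \<and> I (Suc i) (nset ''i'' 0 (Suc i) s'))"
          using K I i by (intro halts_straight) (auto simp: K_def I_def less_Suc_eq)
      qed simp
    qed simp
  qed (auto simp: algebra_simps)
qed

section \<open>Processing all rows\<close>

definition inputs ::
    "nat \<Rightarrow> nat \<Rightarrow> (nat \<Rightarrow> nat \<Rightarrow> nat) \<Rightarrow> (nat \<Rightarrow> nat) \<Rightarrow> (nat \<Rightarrow> real) \<Rightarrow> state \<Rightarrow> bool"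
  where "inputs m n A d x s \<longleftrightarrow>
    nats s ''m'' 0 = m \<and> nats s ''n'' 0 = n \<and> (\<forall>r<m. nats s ''d'' r = d r) \<and>
    (\<forall>r<m. \<forall>j<n. nats s ''A'' (r * n + j) = A r j) \<and> (\<forall>i<n. reals s ''x'' i = x i)"

lemma inputs_keeps:
  assumes "inputs m n A d x s" "keeps W s s'" "W \<inter> {''m'', ''n'', ''d'', ''A'', ''x''} = {}"
  shows "inputs m n A d x s'"
proof -
  have "nats s' v = nats s v \<and> reals s' v = reals s v" if "v \<in> {''m'', ''n'', ''d'', ''A'', ''x''}" for v
    using assms(2,3) that unfolding keeps_def by blast
  then show ?thesis using assms(1) by (simp add: inputs_def)
qed

definition copy_row :: com
  where "copy_row = Seq (For ''j'' ''n'' (NSet ''a'' (Var ''j'') (NGet ''A'' (NAdd (Var ''o'') (Var ''j'')))))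
    (Assign ''b'' (NGet ''d'' (Var ''r'')))"

lemma copy_row_correct:
  assumes inp: "inputs m n A d x s" and r: "nats s ''r'' 0 = r" "r < m" and o: "nats s ''o'' 0 = r * n"
  shows "halts_within copy_row s (30 * n + 20) (\<lambda>s'. keeps {''a'', ''b'', ''j''} s s' \<and>
    nats s' ''b'' 0 = d r \<and> (\<forall>j<n. nats s' ''a'' j = A r j))"
  unfolding copy_row_def
proof (rule halts_seq)
  define I where "I i s' \<longleftrightarrow> keeps {''a'', ''b'', ''j''} s s' \<and> (\<forall>j<i. nats s' ''a'' j = A r j)" for i s'
  show "halts_within (For ''j'' ''n'' (NSet ''a'' (Var ''j'') (NGet ''A'' (NAdd (Var ''o'') (Var ''j''))))) s
    (30 * n + 10) (I n)"
  proof (rule halts_for[where I = I and M = n and B = 12])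
    show "I 0 (nset ''j'' 0 0 s)" by (simp add: I_def)
    show "nats s' ''n'' 0 = n" if "I i s'" for i s' using that inp by (simp add: I_def keeps_def inputs_def)
    fix j s' assume I: "I j s'" and j: "j < n" "nats s' ''j'' 0 = j"
    have "nats s' ''A'' (r * n + j) = A r j" "nats s' ''o'' 0 = r * n"
      using I inp r o j by (simp_all add: I_def keeps_def inputs_def)
    then show "halts_within (NSet ''a'' (Var ''j'') (NGet ''A'' (NAdd (Var ''o'') (Var ''j'')))) s' 12
        (\<lambda>s'. nats s' ''j'' 0 = j \<and> I (Suc j) (nset ''j'' 0 (Suc j) s'))"
      using I j by (intro halts_straight) (auto simp: I_def less_Suc_eq)
  qed auto
  fix s' assume I: "I n s'"
  have "nats s' ''d'' r = d r" "nats s' ''r'' 0 = r"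
    using I inp r by (simp_all add: I_def keeps_def inputs_def)
  then show "halts_within (Assign ''b'' (NGet ''d'' (Var ''r''))) s' 10
      (\<lambda>s'. keeps {''a'', ''b'', ''j''} s s' \<and> nats s' ''b'' 0 = d r \<and> (\<forall>j<n. nats s' ''a'' j = A r j))"
    using I by (intro halts_straight) (auto simp: I_def)
qed simp

definition select_ones :: com
  where "select_ones = Seq (For ''i'' ''n'' (Cond (RLess (RGet ''x'' (Var ''i'')) (ROfNat (NConst 1)))
      (NSet ''G'' (Var ''i'') (NConst 0)) (NSet ''G'' (Var ''i'') (NConst 1))))
    (Assign ''more'' (NConst 1))"

text \<open>Under \<open>x i \<le> 1\<close> the single comparison \<open>x i < 1\<close> detects
  the ones. They form the starting set, with all fractional digits zero.\<close>

lemma select_ones_correct: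
  assumes n: "nats s ''n'' 0 = n" and x: "\<forall>i<n. reals s ''x'' i = x i" and le: "\<forall>i<n. x i \<le> 1"
  shows "halts_within select_ones s (30 * n + 20) (\<lambda>s'. keeps {''i'', ''G'', ''more''} s s' \<and>
    selected n s' = {i. i < n \<and> x i = 1} \<and> nats s' ''more'' 0 = 1)"
  unfolding select_ones_def
proof (rule halts_seq)
  let ?W = "{''i'', ''G'', ''more''}"
  define I where "I i s' \<longleftrightarrow> keeps ?W s s' \<and> (\<forall>j<i. nats s' ''G'' j = 0 \<longleftrightarrow> x j < 1)" for i s'
  show "halts_within (For ''i'' ''n'' (Cond (RLess (RGet ''x'' (Var ''i'')) (ROfNat (NConst 1)))
      (NSet ''G'' (Var ''i'') (NConst 0)) (NSet ''G'' (Var ''i'') (NConst 1)))) s (30 * n + 10) (I n)"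
  proof (rule halts_for[where I = I and M = n and B = 15])
    show "I 0 (nset ''i'' 0 0 s)" by (simp add: I_def)
    show "nats s' ''n'' 0 = n" if "I i s'" for i s' using that n by (simp add: I_def keeps_def)
    fix j s' assume I: "I j s'" and j: "j < n" "nats s' ''i'' 0 = j"
    have "reals s' ''x'' j = x j" using I x j by (simp add: I_def keeps_def)
    then show "halts_within (Cond (RLess (RGet ''x'' (Var ''i'')) (ROfNat (NConst 1)))
        (NSet ''G'' (Var ''i'') (NConst 0)) (NSet ''G'' (Var ''i'') (NConst 1))) s' 15
        (\<lambda>s'. nats s' ''i'' 0 = j \<and> I (Suc j) (nset ''i'' 0 (Suc j) s'))"
      using I j by (intro halts_straight) (auto simp: I_def less_Suc_eq)
  qed auto
  fix s' assume I: "I n s'"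
  have "nats s' ''G'' j \<noteq> 0 \<longleftrightarrow> x j = 1" if "j < n" for j
    using I le that unfolding I_def by (metis less_le)
  then have "selected n s' = {i. i < n \<and> x i = 1}"
    unfolding selected_def by blast
  then show "halts_within (Assign ''more'' (NConst 1)) s' 10 (\<lambda>s'. keeps ?W s s' \<and>
      selected n s' = {i. i < n \<and> x i = 1} \<and> nats s' ''more'' 0 = 1)"
    using I by (intro halts_straight) (auto simp: I_def selected_nset)
qed simp

text \<open>A violation with any \<open>N\<close> and \<open>k\<close> is first strengthened to the
  smallest \<open>k\<close> and then moved to the canonical set, whose fractional part is among the
  enumerated \<open>G\<close>.\<close>

lemma no_violation_if_no_separation:
  assumes x: "\<forall>i<n. 0 \<le> x i \<and> x i \<le> 1"
    and clear: "\<forall>G\<subseteq>fractional n x. \<forall>t<n. \<not> separates (A r) (d r) x t ({i. i < n \<and> x i = 1} \<union> G - {t})"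
  shows "\<not> violated_gc m n A d x r N t k"
proof
  assume "violated_gc m n A d x r N t k"
  then have g: "gen_config n (A r) (d r) N t k" "\<not> gc_inequality n (A r) (d r) N t k x"
    by (auto simp: violated_gc_def)
  then have N: "N \<subseteq> {..<n}" "t < n" "t \<notin> N" by (auto simp: gen_config_def)
  have "separates (A r) (d r) x t N" using separates_if_violated[OF g] x N(2) by simp
  then have "separates (A r) (d r) x t
      ({i \<in> {..<n}. x i = 1} \<union> {i \<in> N. 0 < x i \<and> x i < 1} - {t})"
    using x N by (intro separates_canonical[where S = "{..<n}"]) simp_all
  moreover have "{i \<in> N. 0 < x i \<and> x i < 1} \<subseteq> fractional n x"
    using N by (auto simp: fractional_def)
  ultimately show False using clear N(2) by simp
qed

text \<open>The offset \<open>o\<close> equals \<open>r * n\<close> at the start of a row; adding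
  \<open>n\<close> at its end keeps this true without a product.\<close>

definition process_row :: com
  where "process_row = Seq copy_row (Seq sort_row (Seq select_ones (Seq enumerate_subsets
    (Assign ''o'' (NAdd (Var ''o'') (Var ''n''))))))"

definition row_cost :: "nat \<Rightarrow> nat \<Rightarrow> nat"
  where "row_cost n q = 2 ^ q * (300 * n * n + 380 * n + 40) + 50 * n * n + 100 * n + 80"

abbreviation "row_vars \<equiv> {''a'', ''b'', ''o''} \<union> sort_vars \<union> enumerate_vars"

lemma process_row_correct:
  assumes inp: "inputs m n A d x s" and r: "nats s ''r'' 0 = r" "r < m" and o: "nats s ''o'' 0 = r * n"
    and x: "\<forall>i<n. 0 \<le> x i \<and> x i \<le> 1" and out: "outcome m n A d x X s"
  shows "halts_within process_row s (row_cost n (card (fractional n x))) (\<lambda>s'. keeps row_vars s s' \<and>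
    nats s' ''o'' 0 = Suc r * n \<and> outcome m n A d x (X \<and> (\<forall>N t k. \<not> violated_gc m n A d x r N t k)) s')"
    (is "halts_within _ _ _ ?Q")
  unfolding process_row_def
proof (rule halts_seq[OF copy_row_correct[OF inp r o]])
  let ?F = "fractional n x" and ?O = "{i. i < n \<and> x i = 1}"
  let ?C = "2 ^ card ?F * (300 * n * n + 380 * n + 40) + 10"
  fix s1 assume s1: "keeps {''a'', ''b'', ''j''} s s1 \<and>
    nats s1 ''b'' 0 = d r \<and> (\<forall>j<n. nats s1 ''a'' j = A r j)"
  have inp1: "inputs m n A d x s1" by (rule inputs_keeps[OF inp conjunct1[OF s1]]) auto
  have n1: "nats s1 ''n'' 0 = n" using inp1 by (simp add: inputs_def)
  have a1: "\<forall>j<n. nats s1 ''a'' j = A r j" using s1 by blast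
  show "halts_within (Seq sort_row (Seq select_ones (Seq enumerate_subsets
      (Assign ''o'' (NAdd (Var ''o'') (Var ''n'')))))) s1 ((n * (50 * n + 40) + 9) + ((30 * n + 20) + (?C + 8))) ?Q"
  proof (rule halts_seq[OF sort_row_correct[OF n1 a1]])
    fix s2 assume s2: "keeps sort_vars s1 s2 \<and> sorts (nats s2 ''p'') (A r) n"
    have k2: "keeps ({''a'', ''b'', ''j''} \<union> sort_vars) s s2"
      by (rule keeps_trans[OF conjunct1[OF s1] conjunct1[OF s2]]) auto
    have inp2: "inputs m n A d x s2" by (rule inputs_keeps[OF inp k2]) auto
    have n2: "nats s2 ''n'' 0 = n" "\<forall>i<n. reals s2 ''x'' i = x i" using inp2 by (simp_all add: inputs_def)
    have ab2: "nats s2 ''b'' 0 = d r" "\<forall>j<n. nats s2 ''a'' j = A r j" using s1 s2 by (simp_all add: keeps_def)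
    have le: "\<forall>i<n. x i \<le> 1" using x by blast
    show "halts_within (Seq select_ones (Seq enumerate_subsets
      (Assign ''o'' (NAdd (Var ''o'') (Var ''n''))))) s2 ((30 * n + 20) + (?C + 8)) ?Q"
    proof (rule halts_seq[OF select_ones_correct[OF n2 le]])
      fix s3 assume s3: "keeps {''i'', ''G'', ''more''} s2 s3 \<and> selected n s3 = ?O \<and> nats s3 ''more'' 0 = 1"
      have k3: "keeps ({''a'', ''b'', ''j''} \<union> sort_vars \<union> {''G'', ''more''}) s s3"
        by (rule keeps_trans[OF k2 conjunct1[OF s3]]) auto
      have inp3: "inputs m n A d x s3" by (rule inputs_keeps[OF inp k3]) auto
      have env3: "row_loaded n (A r) (d r) x s3"
        using inp3 ab2 s2 s3 by (simp add: inputs_def row_loaded_def keeps_def)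
      have r3: "nats s3 ''r'' 0 = r" using k3 r(1) by (simp add: keeps_def)
      have out3: "outcome m n A d x X s3" using outcome_keeps[OF k3] out by simp
      have sel3: "selected n s3 = ?O" "nats s3 ''more'' 0 = 1" using s3 by blast+
      show "halts_within (Seq enumerate_subsets (Assign ''o'' (NAdd (Var ''o'') (Var ''n'')))) s3 (?C + 8) ?Q"
      proof (rule halts_seq[OF enumerate_subsets_correct[OF env3 r3 r(2) sel3 out3 refl]])
        fix s4 assume s4: "keeps enumerate_vars s3 s4 \<and> outcome m n A d x (X \<and>
          (\<forall>G\<subseteq>?F. \<forall>t<n. \<not> separates (A r) (d r) x t (?O \<union> G - {t}))) s4"
        have k4: "keeps row_vars s s4" by (rule keeps_trans[OF k3 conjunct1[OF s4]]) auto
        have "nats s4 ''o'' = nats s3 ''o''" "nats s3 ''o'' = nats s ''o''"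
          using s4 k3 by (simp_all add: keeps_def)
        moreover have "nats s4 ''n'' 0 = n" using k4 inp by (simp add: keeps_def inputs_def)
        moreover have "outcome m n A d x (X \<and> (\<forall>N t k. \<not> violated_gc m n A d x r N t k)) s4"
          by (rule outcome_mono[OF conjunct2[OF s4]])
            (use no_violation_if_no_separation[OF x, of A r d m] in blast)
        ultimately show "halts_within (Assign ''o'' (NAdd (Var ''o'') (Var ''n''))) s4 8 ?Q"
          using k4 o by (intro halts_straight) (simp_all add: outcome_nset)
      qed simp
    qed simp
  qed simp
qed (simp add: row_cost_def algebra_simps)

definition separation :: com
  where "separation = For ''r'' ''m'' process_row"

lemma separation_correct:
  assumes x: "\<forall>i<n. 0 \<le> x i \<and> x i \<le> 1"
  shows "halts_within separation (input_state m n A d c x)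
    (m * (row_cost n (card (fractional n x)) + 12) + 9) (correct_output m n A d x)"
proof -
  let ?s = "input_state m n A d c x"
  define I where "I i s \<longleftrightarrow> inputs m n A d x s \<and> nats s ''o'' 0 = i * n \<and>
    outcome m n A d x (\<forall>r<i. \<forall>N t k. \<not> violated_gc m n A d x r N t k) s" for i s
  have nset_r: "I i (nset ''r'' 0 e s) \<longleftrightarrow> I i s" for i e s
    by (simp add: I_def inputs_def outcome_nset)
  \<comment> \<open>Row-major positions stay within the cells that \<open>input_state\<close> fills
    from the matrix.\<close>
  have "r * n + j < m * n" if "r < m" "j < n" for r j
  proof -
    have "r * n + j < Suc r * n" using that by simp
    also have "\<dots> \<le> m * n" using that by (intro mult_le_mono1) simp
    finally show ?thesis .
  qed
  then have inp: "inputs m n A d x ?s"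
    by (auto simp: inputs_def input_state_def)
  show ?thesis
    unfolding separation_def
  proof (rule halts_for[where I = I and M = m and B = "row_cost n (card (fractional n x))"])
    show "I 0 (nset ''r'' 0 0 ?s)"
      unfolding nset_r using inp by (simp add: I_def) (simp add: outcome_def input_state_def)
    show "nats s ''m'' 0 = m" if "I i s" for i s using that by (simp add: I_def inputs_def)
    fix i s assume I: "I i s" and i: "i < m" "nats s ''r'' 0 = i"
    from I have s: "inputs m n A d x s" "nats s ''o'' 0 = i * n"
        "outcome m n A d x (\<forall>r<i. \<forall>N t k. \<not> violated_gc m n A d x r N t k) s"
      by (simp_all add: I_def)
    show "halts_within process_row s (row_cost n (card (fractional n x)))
        (\<lambda>s'. nats s' ''r'' 0 = i \<and> I (Suc i) (nset ''r'' 0 (Suc i) s'))"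
    proof (rule halts_conseq[OF process_row_correct[OF s(1) i(2,1) s(2) x s(3)]])
      fix s' assume s': "keeps row_vars s s' \<and> nats s' ''o'' 0 = Suc i * n \<and>
        outcome m n A d x ((\<forall>r<i. \<forall>N t k. \<not> violated_gc m n A d x r N t k) \<and>
          (\<forall>N t k. \<not> violated_gc m n A d x i N t k)) s'"
      have "inputs m n A d x s'" by (rule inputs_keeps[OF s(1) conjunct1[OF s']]) auto
      moreover have "outcome m n A d x (\<forall>r<Suc i. \<forall>N t k. \<not> violated_gc m n A d x r N t k) s'"
        by (rule outcome_mono[OF conjunct2[OF conjunct2[OF s']]]) (auto simp: less_Suc_eq)
      moreover have "nats s' ''r'' 0 = i" using s' i by (simp add: keeps_def)
      ultimately show "nats s' ''r'' 0 = i \<and> I (Suc i) (nset ''r'' 0 (Suc i) s')"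
        unfolding nset_r using s' by (simp add: I_def)
    qed simp
  next
    fix s assume "I m s"
    then have out: "outcome m n A d x (\<forall>r<m. \<forall>N t k. \<not> violated_gc m n A d x r N t k) s"
      by (simp add: I_def)
    show "correct_output m n A d x s"
    proof (cases "nats s ''found'' 0 = 0")
      case True
      \<comment> \<open>Ruling out the rows below \<open>m\<close> excludes every violation, as
        \<open>violated_gc\<close> includes the bound on the row.\<close>
      moreover have "r < m" if "violated_gc m n A d x r N t k" for r N t k
        using that by (simp add: violated_gc_def)
      ultimately show ?thesis using out unfolding outcome_def correct_output_def by metis
    next
      case False
      with out have "reported m n A d x s" by (simp add: outcome_def)
      with False show ?thesis unfolding correct_output_def reported_def by (simp only: if_False)
    qed
  qed simp
qed

section \<open>Absorbing lower-order terms of the running time\<close>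

lemma row_cost_le:
  assumes "1 \<le> n"
  shows "row_cost n q \<le> 1000 * (n\<^sup>2 * 2 ^ q)"
proof -
  have n: "n \<le> n\<^sup>2" "1 \<le> n\<^sup>2" using assms by (simp_all add: power2_eq_square)
  have "row_cost n q = 2 ^ q * (300 * n\<^sup>2 + 380 * n + 40) + (50 * n\<^sup>2 + 100 * n + 80)"
    by (simp add: row_cost_def power2_eq_square)
  \<comment> \<open>Since \<open>n\<close> and 1 are at most \<open>n\<^sup>2\<close>, the
    coefficients add up: 720 = 300 + 380 + 40 and 230 = 50 + 100 + 80.\<close>
  also have "\<dots> \<le> 2 ^ q * (720 * n\<^sup>2) + 2 ^ q * (230 * n\<^sup>2)"
  proof (rule add_mono)
    show "2 ^ q * (300 * n\<^sup>2 + 380 * n + 40) \<le> 2 ^ q * (720 * n\<^sup>2)"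
      using n by (intro mult_le_mono2) linarith
    have "50 * n\<^sup>2 + 100 * n + 80 \<le> 1 * (230 * n\<^sup>2)" using n by linarith
    also have "\<dots> \<le> 2 ^ q * (230 * n\<^sup>2)" by (intro mult_le_mono1) simp
    finally show "50 * n\<^sup>2 + 100 * n + 80 \<le> 2 ^ q * (230 * n\<^sup>2)" .
  qed
  finally show ?thesis by (simp add: algebra_simps)
qed

theorem theorem8:
  shows "\<exists>(P :: com) (K :: real).
    \<forall>(m :: nat) (n :: nat) (A :: nat \<Rightarrow> nat \<Rightarrow> nat) (d :: nat \<Rightarrow> nat) (c :: nat \<Rightarrow> nat)
      (x :: nat \<Rightarrow> real) (\<alpha> :: nat).
      lp_optimal m n A d c x \<longrightarrow> card {i. i < n \<and> 0 < x i \<and> x i < 1} \<le> \<alpha> \<longrightarrow>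
      (\<exists>T s. exec P (input_state m n A d c x) T s \<and> correct_output m n A d x s \<and>
        (1 \<le> m \<and> 2 \<le> n \<longrightarrow> real T \<le> K * (real n ^ 2 * 2 ^ \<alpha> * log 2 (real n) * real m)))"
proof (rule exI[of _ separation], rule exI[of _ 1021], intro allI impI)
  fix m n \<alpha> :: nat and A :: "nat \<Rightarrow> nat \<Rightarrow> nat" and d c :: "nat \<Rightarrow> nat" and x :: "nat \<Rightarrow> real"
  assume opt: "lp_optimal m n A d c x" and \<alpha>: "card {i. i < n \<and> 0 < x i \<and> x i < 1} \<le> \<alpha>"
  let ?q = "card (fractional n x)"
  have x: "\<forall>i<n. 0 \<le> x i \<and> x i \<le> 1" using opt by (simp add: lp_optimal_def lp_feasible_def)
  have q: "?q \<le> \<alpha>" using \<alpha> by (simp add: fractional_def)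
  obtain T s where T: "exec separation (input_state m n A d c x) T s" "correct_output m n A d x s"
      "T \<le> m * (row_cost n ?q + 12) + 9"
    using separation_correct[OF x, of m A d c] unfolding halts_within_def by blast
  have "real T \<le> 1021 * (real n ^ 2 * 2 ^ \<alpha> * log 2 (real n) * real m)" if mn: "1 \<le> m \<and> 2 \<le> n"
  proof -
    let ?B = "n\<^sup>2 * 2 ^ \<alpha>"
    have "row_cost n ?q \<le> 1000 * (n\<^sup>2 * 2 ^ ?q)" using mn by (intro row_cost_le) simp
    \<comment> \<open>The run depends on the actual number of fractional coordinates;
      \<open>\<alpha>\<close> enters here, as an upper bound on the exponent.\<close>
    also have "\<dots> \<le> 1000 * ?B" using q by (intro mult_le_mono2) (simp add: power_increasing)
    finally have row: "row_cost n ?q \<le> 1000 * ?B" .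
    have B: "1 \<le> ?B" using mn by simp
    have "m * (row_cost n ?q + 12) \<le> m * (1000 * ?B + 12)" using row by (intro mult_le_mono2) simp
    \<comment> \<open>The closing 9 steps of the row loop are charged to each of the
      \<open>m \<ge> 1\<close> rows. With the 12 steps of loop overhead this gives 21 per row, and
      1021 = 1000 + 21.\<close>
    then have "T \<le> m * (1000 * ?B + 12) + 9 * m" using T(3) mn by linarith
    also have "\<dots> = m * (1000 * ?B + 21)" by (simp add: algebra_simps)
    also have "\<dots> \<le> m * (1021 * ?B)" using B by (intro mult_le_mono2) linarith
    finally have "real T \<le> real (m * (1021 * ?B))" by (simp only: of_nat_le_iff)
    then have "real T \<le> 1021 * (real n ^ 2 * 2 ^ \<alpha> * 1 * real m)" by (simp add: algebra_simps)
    also have "\<dots> \<le> 1021 * (real n ^ 2 * 2 ^ \<alpha> * log 2 (real n) * real m)"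
    proof -
      \<comment> \<open>The logarithm to base 2 is at least 1 from \<open>n = 2\<close> on.\<close>
      have "1 \<le> log 2 (real n)" using mn by (simp add: le_log_iff)
      then show ?thesis by (intro mult_left_mono mult_right_mono) auto
    qed
    finally show ?thesis .
  qed
  with T show "\<exists>T s. exec separation (input_state m n A d c x) T s \<and> correct_output m n A d x s \<and>
    (1 \<le> m \<and> 2 \<le> n \<longrightarrow> real T \<le> 1021 * (real n ^ 2 * 2 ^ \<alpha> * log 2 (real n) * real m))"
    by blast
qed

end
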